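(* Let $FG$ be the group algebra of a group $G$ over a field $F$. If $FG$ has only a finite number of non-zero nilpotent elements, then $F$ is a finite field of characteristic $\operatorname{char}(F)=p$. Additionally, if the group $V(FG)$ of normalized units of $FG$ is an Engel group, then $V(FG)$ is nilpotent and $G$ is a finite group such that $G=\mathrm{Syl}_p(G)\times A$, where $\mathrm{Syl}_p(G)\neq\langle 1\rangle$, $G'\leq \mathrm{Syl}_p(G)$, and $A$ is a central subgroup of $G$.
   Context: $V(FG)$ denotes the group of normalized units of $FG$, i.e. the units $\sum_{g}\alpha_g g$ of $FG$ with augmentation $\sum_g\alpha_g=1$. $G'$ is the commutator subgroup of $G$, and $\mathrm{Syl}_p(G)$ denotes the Sylow $p$-subgroup of $G$. Commutators are $(x_1,x_2)=x_1^{-1}x_2^{-1}x_1x_2$ and $(x_1,\ldots,x_n)=((x_1,\ldots,x_{n-1}),x_n)$. A group $X$ is called an Engel group if for any $x,y\in X$ one has $(x,y,y,\ldots,y)=1$, where $y$ is repeated sufficiently many times depending on $x$ and $y$.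
   Formalization: "Only a finite number of non-zero nilpotent elements" is taken to mean finitely many and at least one; with none the claim fails, e.g. for G trivial and F the rational numbers. *)

theory Defs
  imports
    "HOL-Algebra.Generated_Groups"
    "HOL-Computational_Algebra.Primes"
    "HOL-Library.Poly_Mapping"
begin

text \<open>
  A group \<open>G\<close> is a type \<open>'g\<close> of class \<^class>\<open>group_add\<close>; that class does not assume
  commutativity, and its \<open>+\<close>, \<open>0\<close>, unary minus are the operation, identity and inverse
  of \<open>G\<close>. The convolution product then makes \<open>'g \<Rightarrow>\<^sub>0 'f\<close> the group algebra \<open>FG\<close> of
  \<open>G\<close> over the field \<open>'f\<close>, with \<open>Poly_Mapping.single g 1\<close> as the group element \<open>g\<close>.
  The next record is \<open>G\<close> itself as an object of HOL-Algebra.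
\<close>

definition base_group :: "'g::group_add monoid" where
  "base_group = \<lparr>carrier = UNIV, monoid.mult = (+), one = 0\<rparr>"

definition augmentation :: "('g \<Rightarrow>\<^sub>0 'f::comm_monoid_add) \<Rightarrow> 'f" where
  "augmentation x = (\<Sum>g\<in>Poly_Mapping.keys x. Poly_Mapping.lookup x g)"

definition normalized_units :: "('g::group_add \<Rightarrow>\<^sub>0 'f::field) monoid" where
  "normalized_units =
     \<lparr>carrier = {u. (\<exists>v. u * v = 1 \<and> v * u = 1) \<and> augmentation u = 1},
      monoid.mult = (*), one = 1\<rparr>"

definition commutator :: "('a, 'b) monoid_scheme \<Rightarrow> 'a \<Rightarrow> 'a \<Rightarrow> 'a" where
  "commutator G x y = inv\<^bsub>G\<^esub> x \<otimes>\<^bsub>G\<^esub> inv\<^bsub>G\<^esub> y \<otimes>\<^bsub>G\<^esub> x \<otimes>\<^bsub>G\<^esub> y"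

definition engel_group :: "('a, 'b) monoid_scheme \<Rightarrow> bool" where
  "engel_group G \<longleftrightarrow> group G \<and>
     (\<forall>x\<in>carrier G. \<forall>y\<in>carrier G. \<exists>n\<ge>1. ((\<lambda>z. commutator G z y) ^^ n) x = \<one>\<^bsub>G\<^esub>)"

primrec lower_central :: "('a, 'b) monoid_scheme \<Rightarrow> nat \<Rightarrow> 'a set" where
  "lower_central G 0 = carrier G"
| "lower_central G (Suc n) =
     generate G {commutator G x y | x y. x \<in> lower_central G n \<and> y \<in> carrier G}"

definition nilpotent_group :: "('a, 'b) monoid_scheme \<Rightarrow> bool" where
  "nilpotent_group G \<longleftrightarrow> group G \<and> (\<exists>n. lower_central G n = {\<one>\<^bsub>G\<^esub>})"

text \<open>
  For finite \<open>G\<close> and prime \<open>p\<close> only: \<^const>\<open>order\<close> is \<open>0\<close> on infinite groups.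
\<close>

definition sylow_subgroup :: "nat \<Rightarrow> ('a, 'b) monoid_scheme \<Rightarrow> 'a set \<Rightarrow> bool" where
  "sylow_subgroup p G P \<longleftrightarrow> subgroup P G \<and> card P = p ^ multiplicity p (order G)"

definition internal_direct_product ::
    "('a, 'b) monoid_scheme \<Rightarrow> 'a set \<Rightarrow> 'a set \<Rightarrow> bool" where
  "internal_direct_product G H K \<longleftrightarrow> subgroup H G \<and> subgroup K G \<and>
     (\<lambda>(x, y). x \<otimes>\<^bsub>G\<^esub> y) \<in> iso (G\<lparr>carrier := H\<rparr> \<times>\<times> G\<lparr>carrier := K\<rparr>) G"

definition central_subgroup :: "('a, 'b) monoid_scheme \<Rightarrow> 'a set \<Rightarrow> bool" where
  "central_subgroup G H \<longleftrightarrow> subgroup H G \<and>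
     (\<forall>x\<in>H. \<forall>y\<in>carrier G. x \<otimes>\<^bsub>G\<^esub> y = y \<otimes>\<^bsub>G\<^esub> x)"


lemma group_base_group: "group (base_group :: 'g::group_add monoid)"
proof (rule groupI)
  fix x :: 'g
  show "\<exists>y\<in>carrier base_group. y \<otimes>\<^bsub>base_group\<^esub> x = \<one>\<^bsub>base_group\<^esub>"
    by (auto simp: base_group_def intro!: exI[of _ "- x"])
qed (auto simp: base_group_def add.assoc)

lemma augmentation_superset:
  assumes "finite A" "Poly_Mapping.keys x \<subseteq> A"
  shows "augmentation x = (\<Sum>g\<in>A. Poly_Mapping.lookup x g)"
  unfolding augmentation_def
  by (rule sum.mono_neutral_left) (use assms in \<open>auto simp: in_keys_iff\<close>)

lemma augmentation_add: "augmentation (x + y) = augmentation x + augmentation y"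
proof -
  let ?A = "Poly_Mapping.keys x \<union> Poly_Mapping.keys y"
  have "augmentation z = (\<Sum>g\<in>?A. Poly_Mapping.lookup z g)"
    if "z \<in> {x, y, x + y}" for z
    by (rule augmentation_superset)
       (use that Poly_Mapping.keys_add[of x y] in auto)
  then show ?thesis
    by (simp add: lookup_add sum.distrib)
qed

lemma augmentation_zero [simp]: "augmentation 0 = 0"
  by (simp add: augmentation_def)

lemma augmentation_single [simp]: "augmentation (Poly_Mapping.single g a) = a"
  by (simp add: augmentation_def)

lemma augmentation_one [simp]:
  "augmentation (1 :: 'g::monoid_add \<Rightarrow>\<^sub>0 'f::semiring_1) = 1"
  by (metis augmentation_single single_one)

lemma augmentation_sum: "augmentation (sum f A) = (\<Sum>i\<in>A. augmentation (f i))"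
  by (induction A rule: infinite_finite_induct) (simp_all add: augmentation_add)

lemma sum_single_lookup:
  "(\<Sum>g\<in>Poly_Mapping.keys x. Poly_Mapping.single g (Poly_Mapping.lookup x g)) = x"
  by (rule poly_mapping_eqI)
     (auto simp: lookup_sum lookup_single when_def in_keys_iff)

lemma augmentation_mult:
  fixes x y :: "'g::monoid_add \<Rightarrow>\<^sub>0 'f::semiring_0"
  shows "augmentation (x * y) = augmentation x * augmentation y"
proof -
  have "x * y = (\<Sum>g\<in>Poly_Mapping.keys x. Poly_Mapping.single g (Poly_Mapping.lookup x g)) *
                (\<Sum>h\<in>Poly_Mapping.keys y. Poly_Mapping.single h (Poly_Mapping.lookup y h))"
    by (simp only: sum_single_lookup)
  also have "\<dots> = (\<Sum>g\<in>Poly_Mapping.keys x. \<Sum>h\<in>Poly_Mapping.keys y.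
      Poly_Mapping.single (g + h) (Poly_Mapping.lookup x g * Poly_Mapping.lookup y h))"
    by (simp add: sum_product mult_single)
  finally show ?thesis
    by (simp add: augmentation_sum augmentation_def[of x] augmentation_def[of y] sum_product)
qed

lemma group_normalized_units:
  "group (normalized_units :: ('g::group_add \<Rightarrow>\<^sub>0 'f::field) monoid)"
proof (rule groupI)
  fix u v :: "'g \<Rightarrow>\<^sub>0 'f"
  assume "u \<in> carrier normalized_units" "v \<in> carrier normalized_units"
  then obtain u' v' where "u * u' = 1" "u' * u = 1" "v * v' = 1" "v' * v = 1"
      "augmentation u = 1" "augmentation v = 1"
    by (auto simp: normalized_units_def)
  moreover from this have "(u * v) * (v' * u') = 1" "(v' * u') * (u * v) = 1"
    by (metis mult.assoc mult_1_right)+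
  ultimately show "u \<otimes>\<^bsub>normalized_units\<^esub> v \<in> carrier normalized_units"
    by (auto simp: normalized_units_def augmentation_mult)
next
  fix u :: "'g \<Rightarrow>\<^sub>0 'f"
  assume "u \<in> carrier normalized_units"
  then obtain u' where u: "u * u' = 1" "u' * u = 1" "augmentation u = 1"
    by (auto simp: normalized_units_def)
  then have "augmentation u' = 1"
    by (metis augmentation_mult augmentation_one mult_1)
  with u show "\<exists>v\<in>carrier normalized_units. v \<otimes>\<^bsub>normalized_units\<^esub> u = \<one>\<^bsub>normalized_units\<^esub>"
    by (auto simp: normalized_units_def)
qed (auto simp: normalized_units_def mult.assoc)

end

theory Submission
  imports Defs "HOL-Algebra.Sylow" "HOL-Algebra.Multiplicative_Group"
begin

text \<open>
  Let \<open>x\<close> be a nonzero nilpotent element of \<open>FG\<close>. Its scalar multiples are nilpotent, so \<open>F\<close> is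
  finite, of prime characteristic \<open>p\<close>. It has finitely many conjugates, so its centralizer in \<open>G\<close> has
  finite index; the products \<open>x * c\<close> with \<open>c\<close> in the centralizer are nilpotent with translated
  supports, so the centralizer, and with it \<open>G\<close>, is finite.

  Now let the normalized units form an Engel group. The principal tool is an observation on a unit
  \<open>y\<close> of order prime to \<open>p\<close> and an additive group \<open>N\<close> with \<open>N * N = 0\<close> that is stable under
  conjugation by \<open>y\<close>: the commutator of \<open>1 + n\<close> with \<open>y\<close> is \<open>1 + D n\<close>, where \<open>D\<close> is conjugation by \<open>y\<close>
  minus the identity. The Engel condition makes \<open>D\<close> nilpotent at \<open>n\<close>, and \<open>1 + D\<close> has finite order
  invertible in \<open>F\<close>, whence \<open>D n = 0\<close> (\<open>engel_square_zero_commutes\<close>). Applied to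
  \<open>N = e FG (1 - e)\<close> and \<open>N = (1 - e) FG e\<close> it shows that every idempotent \<open>e\<close> built from units of
  order prime to \<open>p\<close> that commute with it is central (\<open>engel_idempotent_central\<close>).

  The average of a cyclic \<open>p'\<close>-subgroup is such an idempotent, so all these subgroups are normal in
  \<open>G\<close>. By Dedekind's argument two noncommuting \<open>p'\<close>-elements would then produce a copy of the
  quaternion group among the \<open>p'\<close>-elements (\<open>quaternion_pair_if_cyclic_normal\<close>), so that \<open>p\<close> is odd.
  But \<open>-1\<close> is a sum of two squares in \<open>F\<close>, and this yields a noncentral idempotent in the group
  algebra of the quaternion group (\<open>engel_no_quaternion\<close>). So the \<open>p'\<close>-elements commute with one
  another, and a second use of the Engel condition, now for a \<open>p'\<close>-element against an arbitrary group
  element, shows that they are central (\<open>torsion_elems_central\<close>).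

  Sylow's theorem turns this into \<open>G = P \<times> A\<close> with \<open>P\<close> the unique Sylow \<open>p\<close>-subgroup and \<open>A\<close> the central
  group of \<open>p'\<close>-elements. If \<open>P\<close> were trivial, \<open>FG\<close> would be commutative with injective Frobenius map,
  and would have no nonzero nilpotent element. Finally \<open>FG\<close> is generated by \<open>P\<close> over the central
  subring \<open>FA\<close>, and the augmentation ideal \<open>I\<close> of \<open>P\<close> is nilpotent because a \<open>p\<close>-group acting on a
  nonzero finite module of characteristic \<open>p\<close> has a nonzero fixed point. Every element is congruent
  modulo \<open>I\<close> to a central one, so the \<open>n\<close>-th term of the lower central series (counted from \<open>0\<close>) lies
  in \<open>1 + I\<^sup>n\<close>, and the unit group is nilpotent (\<open>nilpotent_normalized_units\<close>).
\<close>

section \<open>Group elements and scalars in the group algebra\<close>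

definition group_elem :: "'g::group_add \<Rightarrow> 'g \<Rightarrow>\<^sub>0 'f::field" where
  "group_elem g = Poly_Mapping.single g 1"

definition scalar :: "'f::field \<Rightarrow> 'g::group_add \<Rightarrow>\<^sub>0 'f" where
  "scalar c = Poly_Mapping.single 0 c"

lemma group_elem_add: "group_elem (g + h) = group_elem g * group_elem h"
  by (simp add: group_elem_def mult_single)

lemma group_elem_0 [simp]: "group_elem 0 = 1"
  by (simp add: group_elem_def)

lemma group_elem_inverse [simp]:
  "group_elem g * group_elem (- g) = 1" "group_elem (- g) * group_elem g = 1"
  by (simp_all flip: group_elem_add)

lemma group_elem_inverse_assoc [simp]:
  "group_elem g * (group_elem (- g) * x) = x" "group_elem (- g) * (group_elem g * x) = x"
  by (simp_all flip: mult.assoc)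

lemma group_elem_eq_iff [simp]:
  "(group_elem g :: 'g::group_add \<Rightarrow>\<^sub>0 'f::field) = group_elem h \<longleftrightarrow> g = h"
  by (metis group_elem_def lookup_single_eq lookup_single_not_eq zero_neq_one)

lemma augmentation_group_elem [simp]: "augmentation (group_elem g) = 1"
  by (simp add: group_elem_def)

lemma augmentation_scalar [simp]: "augmentation (scalar c) = c"
  by (simp add: scalar_def)

lemma augmentation_diff:
  fixes x y :: "'g \<Rightarrow>\<^sub>0 'f::ab_group_add"
  shows "augmentation (x - y) = augmentation x - augmentation y"
  by (metis augmentation_add diff_add_cancel eq_diff_eq)

lemma scalar_simps [simp]:
  "scalar 0 = 0" "scalar 1 = 1"
  by (simp_all add: scalar_def)

lemma scalar_add: "scalar (a + b) = scalar a + scalar b"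
  by (simp add: scalar_def single_add)

lemma scalar_mult: "scalar (a * b) = scalar a * scalar b"
  by (simp add: scalar_def mult_single)

lemma scalar_minus: "scalar (- a) = - scalar a"
  by (simp add: scalar_def single_uminus)

lemma scalar_diff: "scalar (a - b) = scalar a - scalar b"
  by (simp add: scalar_def single_diff)

lemma scalar_of_nat: "scalar (of_nat n) = of_nat n"
  by (simp add: scalar_def)

lemma lookup_mult_group_elem:
  "Poly_Mapping.lookup (x * group_elem h) (g + h) = Poly_Mapping.lookup x g"
proof -
  have "x * group_elem h =
      (\<Sum>k\<in>Poly_Mapping.keys x. Poly_Mapping.single k (Poly_Mapping.lookup x k)) * group_elem h"
    by (simp only: sum_single_lookup)
  also have "\<dots> = (\<Sum>k\<in>Poly_Mapping.keys x. Poly_Mapping.single (k + h) (Poly_Mapping.lookup x k))"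
    by (simp add: sum_distrib_right group_elem_def mult_single)
  finally show ?thesis
    by (simp add: lookup_sum lookup_single when_def in_keys_iff)
qed

lemma sum_scalar_group_elem:
  "(\<Sum>g\<in>Poly_Mapping.keys x. scalar (Poly_Mapping.lookup x g) * group_elem g) = x"
  using sum_single_lookup[of x] by (simp add: scalar_def group_elem_def mult_single)

lemma scalar_commute: "scalar c * x = x * scalar c"
proof -
  have "scalar c * (\<Sum>g\<in>Poly_Mapping.keys x. scalar (Poly_Mapping.lookup x g) * group_elem g) =
      (\<Sum>g\<in>Poly_Mapping.keys x. scalar (Poly_Mapping.lookup x g) * group_elem g) * scalar c"
    by (simp add: sum_distrib_left sum_distrib_right scalar_def group_elem_def mult_single mult_ac)
  then show ?thesis by (simp only: sum_scalar_group_elem)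
qed

lemma scalar_commute_assoc: "x * (scalar c * y) = scalar c * (x * y)"
  by (metis mult.assoc scalar_commute)

lemma scalar_mult_eq_0_iff:
  "scalar c * x = 0 \<longleftrightarrow> c = 0 \<or> x = 0"
proof
  assume *: "scalar c * x = 0"
  have "x = 0" if "c \<noteq> 0"
  proof -
    have "x = scalar (inverse c) * (scalar c * x)"
      using that by (simp flip: mult.assoc scalar_mult)
    with * show ?thesis by simp
  qed
  then show "c = 0 \<or> x = 0" by blast
qed auto

lemma of_nat_mult_eq_0_iff:
  fixes x :: "'g::group_add \<Rightarrow>\<^sub>0 'f::field"
  shows "of_nat n * x = 0 \<longleftrightarrow> of_nat n = (0::'f) \<or> x = 0"
  by (metis scalar_mult_eq_0_iff scalar_of_nat)

lemma central_if_commutes_with_group: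
  assumes "\<And>g. x * group_elem g = group_elem g * x"
  shows "x * y = y * x"
proof -
  have "x * (\<Sum>g\<in>Poly_Mapping.keys y. scalar (Poly_Mapping.lookup y g) * group_elem g) =
      (\<Sum>g\<in>Poly_Mapping.keys y. scalar (Poly_Mapping.lookup y g) * group_elem g) * x"
    by (simp add: sum_distrib_left sum_distrib_right scalar_commute_assoc assms mult.assoc)
  then show ?thesis by (simp only: sum_scalar_group_elem)
qed

section \<open>Finiteness of the field and of the group\<close>

lemma power_mult_commute:
  fixes x y :: "'a::monoid_mult"
  assumes "x * y = y * x"
  shows "(x * y) ^ n = x ^ n * y ^ n"
proof (induction n)
  case (Suc n)
  have "y * x ^ n = x ^ n * y"
    by (metis assms power_commuting_commutes)
  with Suc show ?case by (simp add: mult.assoc) (metis mult.assoc)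
qed simp

lemma power_conjugate:
  fixes x :: "'a::monoid_mult"
  assumes "v * u = 1"
  shows "(u * x * v) ^ n = (if n = 0 then 1 else u * x ^ n * v)"
proof (induction n)
  case (Suc n)
  have "u * x * v * (u * x ^ n * v) = u * x * (v * u) * x ^ n * v"
    by (simp only: mult.assoc)
  with Suc assms show ?case by (auto simp: mult.assoc)
qed simp

text \<open>
  Distinct scalars give distinct multiples of \<open>x\<close>, and all of them are nilpotent.
\<close>

lemma finite_field_if_finite_nilpotents:
  fixes x :: "'g::group_add \<Rightarrow>\<^sub>0 'f::field"
  assumes fin: "finite {x :: 'g \<Rightarrow>\<^sub>0 'f. x \<noteq> 0 \<and> (\<exists>n. x ^ n = 0)}"
    and x: "x \<noteq> 0" "x ^ n = 0"
  shows "finite (UNIV :: 'f set)"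
proof -
  let ?f = "\<lambda>c. scalar c * x"
  have "?f ` (UNIV - {0}) \<subseteq> {x. x \<noteq> 0 \<and> (\<exists>n. x ^ n = 0)}"
    using x by (auto simp: scalar_mult_eq_0_iff power_mult_commute[OF scalar_commute] intro!: exI[of _ n])
  then have "finite (?f ` (UNIV - {0}))" using fin by (rule finite_subset)
  moreover have "inj_on ?f (UNIV - {0})"
  proof (rule inj_onI)
    fix c d assume "?f c = ?f d"
    then have "scalar (c - d) * x = 0"
      by (simp add: scalar_diff left_diff_distrib)
    then have "c - d = 0" using x by (simp only: scalar_mult_eq_0_iff) simp
    then show "c = d" by simp
  qed
  ultimately have "finite (UNIV - {0::'f})"
    by (rule finite_imageD)
  then show ?thesis by simp
qed

text \<open>
  The conjugates of \<open>x\<close> are nilpotent, so for infinite \<open>G\<close> infinitely many elements of \<open>G\<close> give the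
  same conjugate and the centralizer of \<open>x\<close> is infinite. For \<open>c\<close> in the centralizer \<open>x * c\<close> is
  nilpotent, and its support is that of \<open>x\<close> translated by \<open>c\<close>; but the supports of all nilpotent
  elements together form a finite set.
\<close>

lemma finite_group_if_finite_nilpotents:
  fixes x :: "'g::group_add \<Rightarrow>\<^sub>0 'f::field"
  assumes fin: "finite {x :: 'g \<Rightarrow>\<^sub>0 'f. x \<noteq> 0 \<and> (\<exists>n. x ^ n = 0)}" (is "finite ?N")
    and x: "x \<noteq> 0" "x ^ n = 0"
  shows "finite (UNIV :: 'g set)"
proof (rule ccontr)
  assume inf: "infinite (UNIV :: 'g set)"
  from x have n: "n \<noteq> 0" by (metis power_0 mult_1_right mult_zero_right)
  let ?conj = "\<lambda>g. group_elem (- g) * x * group_elem g"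
  have "?conj g \<in> ?N" for g
  proof -
    have "x = group_elem g * ?conj g * group_elem (- g)" by (simp add: mult.assoc)
    then have "?conj g \<noteq> 0" using x by force
    moreover have "?conj g ^ n = 0" using n x by (simp add: power_conjugate)
    ultimately show ?thesis by blast
  qed
  then have "range ?conj \<subseteq> ?N" by (rule image_subsetI)
  then have "finite (range ?conj)" using fin by (rule finite_subset)
  with inf obtain h where h: "infinite {g. ?conj g = ?conj h}"
    using pigeonhole_infinite[of UNIV ?conj] by auto
  let ?C = "{c. x * group_elem c = group_elem c * x}"
  have "(\<lambda>g. g - h) ` {g. ?conj g = ?conj h} \<subseteq> ?C"
  proof clarify
    fix g assume *: "?conj g = ?conj h"
    have "x * group_elem (g - h) = group_elem g * ?conj g * group_elem (- h)"
      by (simp add: mult.assoc group_elem_add diff_conv_add_uminus del: add_uminus_conv_diff)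
    also have "\<dots> = group_elem (g - h) * x"
      by (subst *) (simp add: mult.assoc group_elem_add diff_conv_add_uminus del: add_uminus_conv_diff)
    finally show "x * group_elem (g - h) = group_elem (g - h) * x" .
  qed
  moreover have "inj_on (\<lambda>g. g - h) {g. ?conj g = ?conj h}" by (simp add: inj_on_def)
  ultimately have C: "infinite ?C" using h by (meson finite_imageD finite_subset)
  obtain k where k: "Poly_Mapping.lookup x k \<noteq> 0"
    using x by (metis lookup_zero poly_mapping_eqI)
  have "?C \<subseteq> (\<lambda>g. - k + g) ` (\<Union>y\<in>?N. Poly_Mapping.keys y)"
  proof
    fix c assume "c \<in> ?C"
    then have "(x * group_elem c) ^ n = 0" using x by (simp add: power_mult_commute)
    moreover have lk: "Poly_Mapping.lookup (x * group_elem c) (k + c) \<noteq> 0"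
      using k by (simp add: lookup_mult_group_elem)
    moreover from lk have "x * group_elem c \<noteq> 0" by force
    ultimately have "k + c \<in> (\<Union>y\<in>?N. Poly_Mapping.keys y)"
      by (auto simp: in_keys_iff intro!: exI[of _ "x * group_elem c"])
    then show "c \<in> (\<lambda>g. - k + g) ` (\<Union>y\<in>?N. Poly_Mapping.keys y)"
      by (intro image_eqI[of _ _ "k + c"]) (simp_all add: add.assoc[symmetric])
  qed
  moreover have "finite ((\<lambda>g. - k + g) ` (\<Union>y\<in>?N. Poly_Mapping.keys y))"
    using fin by simp
  ultimately show False using C finite_subset by blast
qed

lemma finite_group_algebra:
  assumes "finite (UNIV :: 'f::field set)" "finite (UNIV :: 'g::group_add set)"
  shows "finite (UNIV :: ('g \<Rightarrow>\<^sub>0 'f) set)"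
proof (rule finite_imageD)
  have "finite (UNIV :: ('g \<Rightarrow> 'f) set)"
    using finite_set_of_finite_funs[OF assms(2,1)] by simp
  then show "finite (range (Poly_Mapping.lookup :: ('g \<Rightarrow>\<^sub>0 'f) \<Rightarrow> _))"
    by (meson finite_subset subset_UNIV)
  show "inj (Poly_Mapping.lookup :: ('g \<Rightarrow>\<^sub>0 'f) \<Rightarrow> _)"
    by (simp add: lookup_inject inj_def)
qed

section \<open>Torsion monoids whose cyclic submonoids are normal\<close>

text \<open>
  Meaningful only for elements with a positive power equal to \<open>1\<close>.
\<close>

definition exponent_order :: "'a::monoid_mult \<Rightarrow> nat" where
  "exponent_order x = (LEAST n. 0 < n \<and> x ^ n = 1)"

lemma exponent_order:
  fixes x :: "'a::monoid_mult"
  assumes "x ^ s = 1" "0 < s"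
  shows "0 < exponent_order x" "x ^ exponent_order x = 1"
    "x ^ n = 1 \<longleftrightarrow> exponent_order x dvd n"
proof -
  let ?o = "exponent_order x"
  show o: "0 < ?o" "x ^ ?o = 1"
    using LeastI[of "\<lambda>n. 0 < n \<and> x ^ n = 1" s] assms unfolding exponent_order_def by auto
  show "x ^ n = 1 \<longleftrightarrow> ?o dvd n"
  proof
    assume n: "x ^ n = 1"
    have "x ^ (?o * (n div ?o) + n mod ?o) = x ^ (n mod ?o)"
      unfolding power_add power_mult o(2) by simp
    then have "x ^ (n mod ?o) = 1" using n by simp
    moreover have "n mod ?o < ?o" using o by simp
    ultimately have "n mod ?o = 0"
      using not_less_Least[of "n mod ?o" "\<lambda>n. 0 < n \<and> x ^ n = 1"]
      by (auto simp: exponent_order_def)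
    then show "?o dvd n" by auto
  next
    assume "?o dvd n"
    then show "x ^ n = 1" using o by (auto simp: power_mult elim!: dvdE)
  qed
qed

lemma exponent_order_le:
  fixes x :: "'a::monoid_mult"
  assumes "x ^ n = 1" "0 < n"
  shows "exponent_order x \<le> n"
  using assms unfolding exponent_order_def by (intro Least_le) simp

lemma power_gcd_eq_1:
  fixes x :: "'a::monoid_mult"
  assumes "x ^ a = 1" "x ^ b = 1"
  shows "x ^ gcd a b = 1"
proof (cases "a = 0")
  case False
  then show ?thesis using exponent_order(3)[OF assms(1), of b] exponent_order(3)[OF assms(1), of a]
      exponent_order(3)[OF assms(1), of "gcd a b"] assms by simp
qed (use assms in simp)

lemma eq_1_if_coprime_powers_eq_1:
  fixes x :: "'a::monoid_mult"
  assumes "x ^ a = 1" "x ^ b = 1" "coprime a b"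
  shows "x = 1"
  using power_gcd_eq_1[OF assms(1,2)] assms(3) by simp

text \<open>
  The next two facts are the commutator calculus in a group of class two, where \<open>z\<close> is the central
  commutator of \<open>g\<close> and \<open>h\<close>; inverses are avoided so that they apply to units of a ring as they are.
\<close>

lemma commutator_bilinear:
  fixes g h z :: "'a::monoid_mult"
  assumes gh: "g * h = z * h * g" and zg: "z * g = g * z" and zh: "z * h = h * z"
  shows "g ^ a * h ^ b = z ^ (a * b) * h ^ b * g ^ a"
proof -
  have one: "g * h ^ b = z ^ b * h ^ b * g" for b
  proof (induction b)
    case (Suc b)
    have "g * h ^ Suc b = (g * h) * h ^ b" by (simp add: mult.assoc)
    also have "\<dots> = z * h * (g * h ^ b)" by (simp add: gh mult.assoc)
    also have "\<dots> = z * (h * z ^ b) * h ^ b * g" by (simp add: Suc mult.assoc)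
    also have "h * z ^ b = z ^ b * h" using zh by (metis power_commuting_commutes)
    finally show ?case by (simp add: mult.assoc)
  qed simp
  show ?thesis
  proof (induction a)
    case (Suc a)
    have "g ^ Suc a * h ^ b = g * (g ^ a * h ^ b)" by (simp add: mult.assoc)
    also have "\<dots> = (g * z ^ (a * b)) * h ^ b * g ^ a" by (simp add: Suc mult.assoc)
    also have "g * z ^ (a * b) = z ^ (a * b) * g" using zg by (metis power_commuting_commutes)
    also have "z ^ (a * b) * g * h ^ b * g ^ a = z ^ (a * b) * (g * h ^ b) * g ^ a"
      by (simp only: mult.assoc)
    also have "g * h ^ b = z ^ b * h ^ b * g" by (rule one)
    also have "z ^ (a * b) * (z ^ b * h ^ b * g) * g ^ a = z ^ (a * b + b) * h ^ b * g ^ Suc a"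
      by (simp only: power_add power_Suc mult.assoc)
    finally show ?case by (simp add: add.commute)
  qed simp
qed

lemma product_power_class_2:
  fixes g h z :: "'a::monoid_mult"
  assumes gh: "g * h = z * h * g" and zg: "z * g = g * z" and zh: "z * h = h * z"
  shows "(h * g ^ d) ^ n = h ^ n * g ^ (d * n) * z ^ (d * (n choose 2))"
proof (induction n)
  case (Suc n)
  have zc: "z ^ i * h ^ j = h ^ j * z ^ i" "z ^ i * g ^ j = g ^ j * z ^ i" for i j
    using zg zh by (metis power_commuting_commutes)+
  have "(h * g ^ d) ^ Suc n = (h * g ^ d) ^ n * (h * g ^ d)" by (rule power_Suc2)
  also have "\<dots> = h ^ n * g ^ (d * n) * (z ^ (d * (n choose 2)) * h ^ 1) * g ^ d"
    by (simp add: Suc mult.assoc)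
  also have "\<dots> = h ^ n * (g ^ (d * n) * h ^ 1) * z ^ (d * (n choose 2)) * g ^ d"
    by (simp only: zc mult.assoc)
  also have "g ^ (d * n) * h ^ 1 = z ^ (d * n * 1) * h ^ 1 * g ^ (d * n)"
    by (rule commutator_bilinear[OF gh zg zh])
  also have "h ^ n * (z ^ (d * n * 1) * h ^ 1 * g ^ (d * n)) * z ^ (d * (n choose 2)) * g ^ d
      = (h ^ n * h ^ 1) * (g ^ (d * n) * g ^ d) * (z ^ (d * n) * z ^ (d * (n choose 2)))"
  proof -
    have zc': "z ^ i * (h ^ j * w) = h ^ j * (z ^ i * w)" "z ^ i * (g ^ j * w) = g ^ j * (z ^ i * w)"
      for i j w using zc by (metis mult.assoc)+
    show ?thesis by (simp only: mult_1_right mult.assoc zc zc')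
  qed
  also have "\<dots> = h ^ Suc n * g ^ (d * Suc n) * z ^ (d * (Suc n choose 2))"
    by (simp flip: power_add add: numeral_2_eq_2 algebra_simps power_commutes)
  finally show ?case .
qed (simp add: numeral_2_eq_2)


lemma exponent_order_prime_power:
  fixes x :: "'a::monoid_mult"
  assumes x: "x ^ s = 1" "0 < s" "x \<noteq> 1"
    and unique: "\<And>r. Factorial_Ring.prime r \<Longrightarrow> r dvd exponent_order x \<Longrightarrow> r = r0"
  shows "\<exists>b. exponent_order x = r0 ^ Suc b"
proof -
  let ?o = "exponent_order x"
  note o = exponent_order[OF x(1,2)]
  have o1: "?o \<noteq> 1" using o x by (metis power_one_right)
  then obtain r where "Factorial_Ring.prime r" "r dvd ?o" using prime_factor_nat by blast
  then have r0: "Factorial_Ring.prime r0" using unique by blast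
  obtain t where t: "?o = r0 ^ multiplicity r0 ?o * t" "\<not> r0 dvd t"
    using o(1) r0 by (metis multiplicity_decompose' not_prime_unit less_numeral_extra(3))
  have "t = 1"
  proof (rule ccontr)
    assume "t \<noteq> 1"
    then obtain r where "Factorial_Ring.prime r" "r dvd t" using prime_factor_nat by blast
    with unique t show False by (metis dvd_mult)
  qed
  then have "?o = r0 ^ multiplicity r0 ?o" using t by simp
  with o1 show ?thesis by (metis not0_implies_Suc power_0)
qed

text \<open>
  Minimality is asked for \<open>h\<close> first, among all elements outside the centre; then \<open>g\<close> is minimal among
  the elements that do not commute with this \<open>h\<close>. Powers of \<open>h\<close> of smaller order than \<open>h\<close> are
  therefore central, and powers of \<open>g\<close> of smaller order than \<open>g\<close> commute with \<open>h\<close>.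
\<close>

lemma minimal_noncommuting_pair:
  fixes X :: "'a::monoid_mult set"
  assumes "g0 \<in> X" "h0 \<in> X" "g0 * h0 \<noteq> h0 * g0"
  obtains g h where "g \<in> X" "h \<in> X" "g * h \<noteq> h * g"
    "\<And>x y. x \<in> X \<Longrightarrow> y \<in> X \<Longrightarrow> x * y \<noteq> y * x \<Longrightarrow> exponent_order h \<le> exponent_order x"
    "\<And>x. x \<in> X \<Longrightarrow> x * h \<noteq> h * x \<Longrightarrow> exponent_order g \<le> exponent_order x"
proof -
  let ?N = "\<lambda>x. x \<in> X \<and> (\<exists>y\<in>X. x * y \<noteq> y * x)"
  have "?N h0" using assms by metis
  then obtain h where h: "?N h" "\<And>x. ?N x \<Longrightarrow> exponent_order h \<le> exponent_order x"
    using ex_has_least_nat[of ?N h0 exponent_order] by metis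
  then obtain g' where "g' \<in> X" "g' * h \<noteq> h * g'" by metis
  then obtain g where "g \<in> X" "g * h \<noteq> h * g"
      "\<And>x. x \<in> X \<and> x * h \<noteq> h * x \<Longrightarrow> exponent_order g \<le> exponent_order x"
    using ex_has_least_nat[of "\<lambda>x. x \<in> X \<and> x * h \<noteq> h * x" g' exponent_order] by metis
  with h that show ?thesis by blast
qed

text \<open>
  This is the heart of Dedekind's theorem on groups all of whose subgroups are normal. For a minimal
  noncommuting pair, the commutator \<open>z\<close> lies in both cyclic groups, hence is central in the group they
  generate. Minimality forces \<open>z\<close> to have prime order \<open>r\<close>, and \<open>g\<close> and \<open>h\<close> to have orders that are powers
  of \<open>r\<close>. Multiplying \<open>h\<close> by a suitable power \<open>g ^ d\<close> cancels the top power of \<open>h\<close>, which contradicts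
  minimality except when the correction term \<open>z ^ (d * (n choose 2))\<close> of the class-two power formula
  survives; this happens only if \<open>r = 2\<close> and both orders are \<open>4\<close>.
\<close>

lemma quaternion_pair_if_cyclic_normal:
  fixes X :: "'a::monoid_mult set"
  assumes s: "0 < s" "\<And>x. x \<in> X \<Longrightarrow> x ^ s = 1"
    and closed: "\<And>x y. x \<in> X \<Longrightarrow> y \<in> X \<Longrightarrow> x * y \<in> X"
    and normal: "\<And>x y. x \<in> X \<Longrightarrow> y \<in> X \<Longrightarrow> \<exists>i. x * y = y * x ^ i"
    and nc: "g0 \<in> X" "h0 \<in> X" "g0 * h0 \<noteq> h0 * g0"
  shows "\<exists>g\<in>X. \<exists>h\<in>X. \<exists>z. g * g = z \<and> h * h = z \<and> z * z = 1 \<and> z \<noteq> 1 \<and> g * h = z * h * g"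
proof -
  obtain g h where g: "g \<in> X" and h: "h \<in> X" and gh: "g * h \<noteq> h * g"
    and min_h: "\<And>x y. x \<in> X \<Longrightarrow> y \<in> X \<Longrightarrow> x * y \<noteq> y * x \<Longrightarrow> exponent_order h \<le> exponent_order x"
    and min_g: "\<And>x. x \<in> X \<Longrightarrow> x * h \<noteq> h * x \<Longrightarrow> exponent_order g \<le> exponent_order x"
    using minimal_noncommuting_pair[OF nc] by metis
  have inv: "x ^ (s - 1) * x = 1" "x * x ^ (s - 1) = 1" if "x \<in> X" for x
    using s that by (metis power_minus_mult, metis Suc_diff_1 power_Suc)
  have inv_assoc: "x ^ (s - 1) * (x * w) = w" "x * (x ^ (s - 1) * w) = w" if "x \<in> X" for x w
    using inv[OF that] by (metis mult.assoc mult_1_left)+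
  have cancel: "x * v = x * w \<Longrightarrow> v = w" if "x \<in> X" for x v w
    using inv_assoc[OF that] by metis
  have pow: "x ^ n \<in> X" if "x \<in> X" for x n
  proof -
    have "x ^ Suc k \<in> X" for k by (induction k) (use that closed in auto)
    then show ?thesis by (cases n) (metis s that Suc_pred power_0, blast)
  qed
  have ordg: "0 < exponent_order g" "\<And>n. g ^ n = 1 \<longleftrightarrow> exponent_order g dvd n"
    and ordh: "0 < exponent_order h" "\<And>n. h ^ n = 1 \<longleftrightarrow> exponent_order h dvd n"
    using exponent_order[OF s(2) s(1)] g h by blast+
  obtain i where i: "g * h = h * g ^ i" using normal g h by blast
  define z where "z = g ^ (i + (s - 1))"
  have zg: "z * g = g * z" unfolding z_def by (rule power_commutes)
  have hz: "g * h = h * z * g"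
    unfolding z_def power_add by (simp add: i mult.assoc inv[OF g, unfolded One_nat_def])
  obtain j where j: "h * g ^ (s - 1) = g ^ (s - 1) * h ^ j" using normal[OF h pow[OF g]] by blast
  have z_h: "z = h ^ (s - 1 + j)"
  proof (rule cancel[OF h])
    have "h * z = g * (h * g ^ (s - 1))"
      using hz by (metis mult.assoc inv(2)[OF g] mult_1_right)
    also have "\<dots> = h ^ j" by (simp only: j inv_assoc[OF g])
    also have "\<dots> = h * h ^ (s - 1 + j)" by (simp only: power_add inv_assoc[OF h])
    finally show "h * z = h * h ^ (s - 1 + j)" .
  qed
  have zh: "z * h = h * z" unfolding z_h by (rule power_commutes)
  have gh': "g * h = z * h * g" using hz zh by simp
  have z1: "z \<noteq> 1" using gh gh' by auto
  note class2 = commutator_bilinear[OF gh' zg zh] product_power_class_2[OF gh' zg zh]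
  have right_cancel: "v = 1" if "v * w = w" "w \<in> X" for v w
    using that by (metis inv(2) mult.assoc mult_1_right)
  have smaller: "exponent_order (x ^ r) < exponent_order x" if "x \<in> X" "Factorial_Ring.prime r" "r dvd exponent_order x" for x r
  proof -
    have o: "0 < exponent_order x" "x ^ exponent_order x = 1"
      using exponent_order[OF s(2) s(1)] that by blast+
    obtain k where k: "exponent_order x = r * k" using \<open>r dvd exponent_order x\<close> by blast
    then have "(x ^ r) ^ k = 1" "0 < k" using o by (simp_all add: power_mult)
    then have "exponent_order (x ^ r) \<le> k" by (rule exponent_order_le)
    also have "k < r * k" using \<open>0 < k\<close> prime_gt_1_nat[OF \<open>Factorial_Ring.prime r\<close>] by simp
    finally show ?thesis by (simp only: k)
  qed
  \<comment> \<open>The commutator of g and h ^ r is z ^ r, and h ^ r is central as its order is less than that of h.\<close>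
  have zr_h: "z ^ r = 1" if r: "Factorial_Ring.prime r" "r dvd exponent_order h" for r
  proof -
    have "h ^ r * g = g * h ^ r"
      using min_h[OF pow[OF h] g, of r] smaller[OF h r] by (metis linorder_not_le)
    then show ?thesis
      using class2(1)[of 1 r] right_cancel[OF _ closed[OF pow[OF h] g], of "z ^ r" r]
      by (simp add: mult.assoc)
  qed
  have zr_g: "z ^ r = 1" if r: "Factorial_Ring.prime r" "r dvd exponent_order g" for r
  proof -
    have "g ^ r * h = h * g ^ r"
      using min_g[OF pow[OF g], of r] smaller[OF g r] by (metis linorder_not_le)
    then show ?thesis
      using class2(1)[of r 1] right_cancel[OF _ closed[OF h pow[OF g]], of "z ^ r" r]
      by (simp add: mult.assoc)
  qed
  have "h \<noteq> 1" "g \<noteq> 1" using gh by auto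
  then have "exponent_order h \<noteq> 1" using ordh(2)[of 1] by auto
  then obtain r where r: "Factorial_Ring.prime r" "r dvd exponent_order h" using prime_factor_nat by blast
  have zr: "z ^ r = 1" using zr_h r by blast
  have unique: "r' = r" if "Factorial_Ring.prime r'" "z ^ r' = 1" for r'
    using eq_1_if_coprime_powers_eq_1[OF zr that(2)] z1 that r primes_coprime by metis
  obtain b where b: "exponent_order h = r ^ Suc b"
    using exponent_order_prime_power[OF s(2)[OF h] s(1) \<open>h \<noteq> 1\<close>, of r] unique zr_h by blast
  obtain a where a: "exponent_order g = r ^ Suc a"
    using exponent_order_prime_power[OF s(2)[OF g] s(1) \<open>g \<noteq> 1\<close>, of r] unique zr_g by blast
  have "b \<le> a"
    using power_le_imp_le_exp[OF prime_gt_1_nat[OF r(1)]] min_h[OF g h gh] a b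
    by (metis Suc_le_mono)
  define \<gamma> where "\<gamma> = g ^ r ^ a"
  define \<eta> where "\<eta> = h ^ r ^ b"
  have \<gamma>r: "\<gamma> ^ r = 1"
    unfolding \<gamma>_def power_mult[symmetric] ordg(2) a by (simp only: power_Suc2 dvd_refl)
  have \<eta>r: "\<eta> ^ r = 1"
    unfolding \<eta>_def power_mult[symmetric] ordh(2) b by (simp only: power_Suc2 dvd_refl)
  have power_of_top: "\<exists>k. z = (x ^ r ^ c) ^ k"
    if "z = x ^ l" "\<And>n. x ^ n = 1 \<longleftrightarrow> exponent_order x dvd n" "exponent_order x = r ^ Suc c" for x l c
  proof -
    have "x ^ (l * r) = 1" using zr that by (simp add: power_mult)
    then have "r ^ c * r dvd l * r" using that by (simp add: mult.commute)
    then have "r ^ c dvd l" using r(1) by (simp add: prime_gt_0_nat)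
    then obtain k where "l = r ^ c * k" by blast
    then show ?thesis using that(1) by (auto simp: power_mult)
  qed
  obtain k where k: "z = \<gamma> ^ k"
    using power_of_top[OF z_def ordg(2) a] unfolding \<gamma>_def by blast
  obtain l where l: "z = \<eta> ^ l"
    using power_of_top[OF z_h ordh(2) b] unfolding \<eta>_def by blast
  have "coprime l r"
  proof (rule ccontr)
    assume "\<not> coprime l r"
    then have "r dvd l" using r(1) by (metis coprime_commute prime_imp_coprime)
    then show False using l \<eta>r z1 by (auto simp: power_mult elim!: dvdE)
  qed
  moreover have "l \<noteq> 0" using l z1 by (metis power_0)
  ultimately obtain x y where "l * x = r * y + 1"
    using bezout_nat[of l r] by (auto simp: coprime_iff_gcd_eq_1)
  moreover have "\<eta> ^ (r * y + 1) = \<eta>" by (simp add: power_mult \<eta>r)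
  ultimately have \<eta>: "\<eta> = z ^ x" unfolding l power_mult[symmetric] by simp
  \<comment> \<open>The exponent d is chosen so that the r ^ b-th power of g ^ d is the inverse of \<open>\<eta>\<close>: the
    factor r ^ (a - b) matches the orders, and r - 1 stands for -1 in exponents modulo r.\<close>
  define d where "d = r ^ (a - b) * (k * x * (r - 1))"
  have "r ^ a = r ^ (a - b) * r ^ b" using \<open>b \<le> a\<close> by (simp flip: power_add)
  then have "d * r ^ b = r ^ a * (k * x * (r - 1))" by (simp add: d_def)
  then have "(g ^ d) ^ r ^ b = \<gamma> ^ (k * x * (r - 1))"
    unfolding \<gamma>_def power_mult[symmetric] by simp
  moreover have "\<eta> = \<gamma> ^ (k * x)" unfolding \<eta> k power_mult[symmetric] ..
  ultimately have "\<eta> * (g ^ d) ^ r ^ b = \<gamma> ^ (k * x + k * x * (r - 1))"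
    by (simp add: power_add)
  also have "k * x + k * x * (r - 1) = r * (k * x)" using r(1)
    by (cases r) auto
  finally have top: "h ^ r ^ b * g ^ (d * r ^ b) = 1"
    unfolding \<eta>_def[symmetric] power_mult[of g] power_mult[of \<gamma>] by (simp add: \<gamma>r)
  \<comment> \<open>Otherwise h * g ^ d has smaller order than h, although it does not commute with g.\<close>
  have dz: "\<not> r dvd d * (r ^ b choose 2)"
  proof
    assume "r dvd d * (r ^ b choose 2)"
    then obtain k where k: "d * (r ^ b choose 2) = r * k" by blast
    have "(h * g ^ d) ^ r ^ b = 1"
      unfolding class2(2) k power_mult[of z] zr top by simp
    then have "exponent_order (h * g ^ d) \<le> r ^ b"
      using r(1) by (simp add: exponent_order_le prime_gt_0_nat)
    also have "r ^ b < exponent_order h" using b prime_gt_1_nat[OF r(1)] by simp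
    finally have "exponent_order (h * g ^ d) < exponent_order h" .
    then have "h * g ^ d * g = g * (h * g ^ d)"
      using min_h[OF closed[OF h pow[OF g]] g] by (metis linorder_not_le)
    then have "h * g * g ^ d = g * h * g ^ d"
      by (metis mult.assoc power_commutes)
    then have "h * g = g * h"
      by (metis mult.assoc inv(2)[OF pow[OF g]] mult_1_right)
    with gh show False by simp
  qed
  have "b \<noteq> 0"
  proof
    assume "b = 0"
    then show False using dz by (simp add: numeral_2_eq_2)
  qed
  have two: "r ^ b choose 2 = r ^ b * (r ^ b - 1) div 2" by (rule choose_two)
  have "r = 2"
  proof (rule ccontr)
    assume "r \<noteq> 2"
    then have "odd r" using r(1) by (metis primes_dvd_imp_eq two_is_prime_nat)
    then have "even (r ^ b - 1)" by simp
    then have "r ^ b choose 2 = r ^ b * ((r ^ b - 1) div 2)" using two by (simp add: div_mult_swap)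
    then show False using dz \<open>b \<noteq> 0\<close> by (simp add: dvd_power)
  qed
  have "b = 1"
  proof (rule ccontr)
    assume "b \<noteq> 1"
    then obtain c where c: "b = Suc (Suc c)" using \<open>b \<noteq> 0\<close> by (metis One_nat_def not0_implies_Suc)
    have "r ^ b choose 2 = 2 * (2 ^ c * (2 ^ b - 1))" using two unfolding \<open>r = 2\<close> c by simp
    then show False using dz \<open>r = 2\<close> by simp
  qed
  have "a = 1"
  proof (rule ccontr)
    assume "a \<noteq> 1"
    then have "0 < a - b" using \<open>b \<le> a\<close> \<open>b = 1\<close> by simp
    then have "r dvd d" unfolding d_def by (simp add: dvd_power)
    with dz show False by simp
  qed
  have eq_z: "w = z" if "w ^ r = 1" "z = w ^ n" for w n
  proof -
    have "w ^ n = w ^ (n mod 2)"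
      using that \<open>r = 2\<close> by (metis mod_mult_div_eq power_add power_mult power_one mult_1_right)
    then show ?thesis using that z1 by (cases "even n") (auto simp: odd_iff_mod_2_eq_one even_iff_mod_2_eq_zero)
  qed
  have "g * g = z" "h * h = z"
    using eq_z[OF \<gamma>r k] eq_z[OF \<eta>r l] \<open>r = 2\<close> \<open>a = 1\<close> \<open>b = 1\<close>
    by (simp_all add: \<gamma>_def \<eta>_def power2_eq_square)
  moreover have "z * z = 1" using zr \<open>r = 2\<close> by (simp add: power2_eq_square)
  ultimately show ?thesis using g h gh' z1 by blast
qed

section \<open>Units of order prime to the characteristic and idempotents\<close>

lemma augmentation_inverse:
  fixes u v :: "'g::group_add \<Rightarrow>\<^sub>0 'f::field"
  assumes "u * v = 1" "augmentation u = 1"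
  shows "augmentation v = 1"
  by (metis assms augmentation_mult augmentation_one mult_1)

lemma commutator_normalized_units:
  fixes u :: "'g::group_add \<Rightarrow>\<^sub>0 'f::field"
  assumes u: "u * u' = 1" "u' * u = 1" "augmentation u = 1"
    and y: "y * y' = 1" "y' * y = 1" "augmentation y = 1"
  shows "commutator normalized_units u y = u' * y' * u * y"
proof -
  have inv: "inv\<^bsub>normalized_units\<^esub> v = v'"
    if "v * v' = 1" "v' * v = 1" "augmentation v = 1" for v v' :: "'g \<Rightarrow>\<^sub>0 'f"
  proof (rule group.inv_equality[OF group_normalized_units])
    have "augmentation v' = 1" using that augmentation_inverse by blast
    with that show "v \<in> carrier normalized_units" "v' \<in> carrier normalized_units"
        "v' \<otimes>\<^bsub>normalized_units\<^esub> v = \<one>\<^bsub>normalized_units\<^esub>"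
      by (auto simp: normalized_units_def)
  qed
  show ?thesis
    unfolding commutator_def inv[OF u] inv[OF y] by (simp add: normalized_units_def)
qed

text \<open>
  If \<open>D (D v) = 0\<close>, then conjugating \<open>j\<close> times adds \<open>j * D v\<close> to \<open>v\<close>; at \<open>j = m\<close> nothing is added, so
  \<open>D v = 0\<close> because \<open>m\<close> is invertible. The general case descends one power of \<open>D\<close> at a time.
\<close>

lemma conjugation_fixed_if_unipotent:
  fixes y y' :: "'g::group_add \<Rightarrow>\<^sub>0 'f::field"
  assumes y: "y * y' = 1" "y' * y = 1" "y ^ m = 1" "of_nat m \<noteq> (0::'f)"
    and D: "\<And>v. D v = y' * v * y - v" "(D ^^ k) v = 0"
  shows "D v = 0"
  using D(2)
proof (induction k arbitrary: v)
  case 0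
  then show ?case by (simp add: D)
next
  case (Suc k)
  have "(D ^^ k) (D v) = 0" using Suc.prems by (simp add: funpow_swap1)
  then have "D (D v) = 0" by (rule Suc.IH)
  then have fixed: "y' * D v * y = D v" by (simp add: D(1)[of "D v"])
  have "y' ^ j * v * y ^ j = v + of_nat j * D v" for j
  proof (induction j)
    case (Suc j)
    have "y' ^ Suc j * v * y ^ Suc j = y' * (y' ^ j * v * y ^ j) * y"
      by (simp only: power_Suc[of y'] power_Suc2[of y] mult.assoc)
    also have "\<dots> = y' * v * y + y' * (of_nat j * D v) * y"
      by (simp only: Suc distrib_left distrib_right)
    also have "y' * (of_nat j * D v) * y = of_nat j * (y' * D v * y)"
      by (metis mult.assoc mult_of_nat_commute)
    finally show ?case by (simp only: fixed) (simp add: D(1) algebra_simps)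
  qed simp
  moreover have "y' ^ m = 1"
    using y power_mult_commute[of y y' m] by simp
  ultimately have "of_nat m * D v = 0" using y(3) by (metis add_cancel_right_right mult_1 mult_1_right)
  then show ?case using y(4) of_nat_mult_eq_0_iff by blast
qed

text \<open>
  As products in \<open>N\<close> vanish, \<open>1 + n\<close> is a normalized unit with inverse \<open>1 - n\<close>, and its commutator with
  \<open>y\<close> is \<open>1 + D n\<close> with \<open>D n\<close> the difference of the conjugate of \<open>n\<close> and \<open>n\<close>. The iterated commutators of
  the Engel condition thus become iterates of the additive map \<open>D\<close>.
\<close>

lemma engel_square_zero_commutes:
  fixes N :: "('g::group_add \<Rightarrow>\<^sub>0 'f::field) set"
  assumes engel: "engel_group (normalized_units :: ('g \<Rightarrow>\<^sub>0 'f) monoid)"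
    and y: "augmentation y = 1" "y ^ m = 1" "of_nat m \<noteq> (0::'f)"
    and N: "\<And>a b. a \<in> N \<Longrightarrow> b \<in> N \<Longrightarrow> a * b = 0" "\<And>a b. a \<in> N \<Longrightarrow> b \<in> N \<Longrightarrow> a - b \<in> N"
      "\<And>a. a \<in> N \<Longrightarrow> y ^ (m - 1) * a * y \<in> N"
    and n: "n \<in> N"
  shows "n * y = y * n"
proof -
  have m: "m \<noteq> 0" using y(3) by (metis of_nat_0)
  define y' where "y' = y ^ (m - 1)"
  have y': "y * y' = 1" "y' * y = 1"
    using m y(2) unfolding y'_def by (metis Suc_pred' gr0I power_Suc, metis Suc_pred' gr0I power_Suc2)
  define D where "D v = y' * v * y - v" for v
  have D_N: "D a \<in> N" if "a \<in> N" for a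
    using that N(2,3) by (simp add: D_def y'_def)
  have aug_N: "augmentation a = 0" if "a \<in> N" for a
    using N(1)[OF that that] augmentation_mult[of a a] by simp
  have comm: "commutator normalized_units (1 + a) y = 1 + D a" if a: "a \<in> N" for a
  proof -
    have "commutator normalized_units (1 + a) y = (1 - a) * y' * (1 + a) * y"
      using N(1)[OF a a] aug_N[OF a] y y'
      by (intro commutator_normalized_units) (simp_all add: augmentation_add algebra_simps)
    also have "\<dots> = (1 - a) * (1 + y' * a * y)"
      using y' by (simp add: mult.assoc distrib_left distrib_right)
    also have "\<dots> = 1 + D a - a * (y' * a * y)"
      by (simp add: D_def algebra_simps)
    also have "a * (y' * a * y) = 0" using a N(1,3) by (simp add: y'_def)
    finally show ?thesis by simp
  qed
  have iterate: "((\<lambda>u. commutator normalized_units u y) ^^ k) (1 + n) = 1 + (D ^^ k) n \<and> (D ^^ k) n \<in> N" for k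
    by (induction k) (simp_all add: n comm D_N)
  have "1 + n \<in> carrier normalized_units"
    using N(1)[OF n n] aug_N[OF n]
    by (auto simp: normalized_units_def augmentation_add algebra_simps intro!: exI[of _ "1 - n"])
  moreover have "y \<in> carrier normalized_units" using y y' by (auto simp: normalized_units_def)
  ultimately obtain k where "((\<lambda>u. commutator normalized_units u y) ^^ k) (1 + n) = 1"
    using engel by (auto simp: engel_group_def normalized_units_def)
  then have "(D ^^ k) n = 0" using iterate[of k] by simp
  then have "D n = 0" using conjugation_fixed_if_unipotent[OF y' y(2,3) D_def] by blast
  then have "y * (y' * n * y) = y * n" by (simp add: D_def)
  then show ?thesis using y' by (simp flip: mult.assoc)
qed

text \<open>
  The corner \<open>e FG (1 - e)\<close> has zero multiplication and is stable under conjugation by every \<open>y \<in> Y\<close>, so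
  its elements \<open>n\<close> commute with \<open>Y\<close> and therefore with \<open>e\<close>; but then \<open>n = e * n = n * e = 0\<close>. The same
  holds for \<open>1 - e\<close>. The last hypothesis says that \<open>e\<close> is in the double centralizer of \<open>Y\<close>, which is how
  membership of \<open>e\<close> in the algebra generated by \<open>Y\<close> enters.
\<close>

lemma engel_idempotent_central:
  fixes e r :: "'g::group_add \<Rightarrow>\<^sub>0 'f::field"
  assumes engel: "engel_group (normalized_units :: ('g \<Rightarrow>\<^sub>0 'f) monoid)"
    and e: "e * e = e"
    and Y: "\<And>y. y \<in> Y \<Longrightarrow> augmentation y = 1"
      "\<And>y. y \<in> Y \<Longrightarrow> \<exists>m. of_nat m \<noteq> (0::'f) \<and> y ^ m = 1"
      "\<And>y. y \<in> Y \<Longrightarrow> e * y = y * e"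
    and generated: "\<And>x. (\<And>y. y \<in> Y \<Longrightarrow> x * y = y * x) \<Longrightarrow> x * e = e * x"
  shows "e * r = r * e"
proof -
  have corner: "f * r * (1 - f) = 0"
    if f: "f * f = f" "\<And>y. y \<in> Y \<Longrightarrow> f * y = y * f"
      "\<And>x. (\<And>y. y \<in> Y \<Longrightarrow> x * y = y * x) \<Longrightarrow> x * f = f * x" for f
  proof -
    define N where "N = {f * x * (1 - f) | x. True}"
    have "(1 - f) * f = 0" using f(1) by (simp add: left_diff_distrib)
    have mult0: "a * b = 0" if ab: "a \<in> N" "b \<in> N" for a b
    proof -
      obtain x x' where "a = f * x * (1 - f)" "b = f * x' * (1 - f)" using ab by (auto simp: N_def)
      then have "a * b = f * x * ((1 - f) * f) * x' * (1 - f)" by (simp only: mult.assoc)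
      then show ?thesis by (simp add: \<open>(1 - f) * f = 0\<close>)
    qed
    have commutes: "(f * r * (1 - f)) * y = y * (f * r * (1 - f))" if y: "y \<in> Y" for y
    proof -
      obtain m where m: "of_nat m \<noteq> (0::'f)" "y ^ m = 1" using Y(2) y by blast
      have diff: "a - b \<in> N" if ab: "a \<in> N" "b \<in> N" for a b
      proof -
        obtain x x' where "a = f * x * (1 - f)" "b = f * x' * (1 - f)" using ab by (auto simp: N_def)
        then have "a - b = f * (x - x') * (1 - f)"
          by (simp only: left_diff_distrib[of _ _ "1 - f"] right_diff_distrib[of f x])
        then show ?thesis by (auto simp: N_def)
      qed
      have conj: "y ^ (m - 1) * a * y \<in> N" if a: "a \<in> N" for a
      proof -
        obtain x where x: "a = f * x * (1 - f)" using a by (auto simp: N_def)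
        have "y ^ (m - 1) * f = f * y ^ (m - 1)"
          using f(2)[OF y] by (metis power_commuting_commutes)
        moreover have "(1 - f) * y = y * (1 - f)" using f(2)[OF y] by (simp add: algebra_simps)
        moreover have "y ^ (m - 1) * a * y = (y ^ (m - 1) * f) * x * ((1 - f) * y)"
          unfolding x by (simp only: mult.assoc)
        ultimately have "y ^ (m - 1) * a * y = f * (y ^ (m - 1) * x * y) * (1 - f)"
          by (simp only: mult.assoc)
        then show ?thesis by (auto simp: N_def)
      qed
      show ?thesis
        by (rule engel_square_zero_commutes[OF engel Y(1)[OF y] m(2,1) mult0 diff conj])
           (auto simp: N_def)
    qed
    have "f * r * (1 - f) = f * (f * r * (1 - f))" using f(1) by (simp flip: mult.assoc)
    also have "\<dots> = (f * r * (1 - f)) * f" by (rule f(3)[OF commutes, symmetric])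
    also have "\<dots> = 0" using \<open>(1 - f) * f = 0\<close> by (simp add: mult.assoc)
    finally show ?thesis .
  qed
  have "e * r * (1 - e) = 0" using e Y(3) generated by (rule corner)
  then have "e * r = e * r * e" by (simp only: right_diff_distrib mult_1_right right_minus_eq)
  moreover have "(1 - e) * r * (1 - (1 - e)) = 0"
  proof (rule corner)
    show "(1 - e) * (1 - e) = 1 - e" using e by (simp add: algebra_simps)
    show "(1 - e) * y = y * (1 - e)" if "y \<in> Y" for y using Y(3)[OF that] by (simp add: algebra_simps)
    show "x * (1 - e) = (1 - e) * x" if "\<And>y. y \<in> Y \<Longrightarrow> x * y = y * x" for x
      using generated[OF that] by (simp add: algebra_simps)
  qed
  then have "r * e = e * r * e"
    by (simp only: diff_diff_eq2 add_diff_cancel_left' left_diff_distrib mult_1_left right_minus_eq)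
  ultimately show ?thesis by simp
qed

section \<open>Group elements of order prime to the characteristic commute\<close>

lemma group_elem_power: "\<exists>k. group_elem h ^ n = group_elem k"
  by (induction n) (auto simp flip: group_elem_add intro: exI[of _ 0])

text \<open>
  The sum \<open>E\<close> of the powers of \<open>h\<close> is a multiple of an idempotent and so is central. A conjugate of \<open>h\<close>
  fixes \<open>E\<close> under multiplication just as \<open>h\<close> does, hence maps the support of \<open>E\<close>, which consists of powers
  of \<open>h\<close>, into itself. The exponent \<open>s\<close> may be any multiple of the order of \<open>h\<close>: \<open>E\<close> is nonzero because
  its augmentation is \<open>s\<close>.
\<close>

lemma engel_cyclic_subgroup_normal:
  fixes h x :: "'g::group_add"
  assumes engel: "engel_group (normalized_units :: ('g \<Rightarrow>\<^sub>0 'f::field) monoid)"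
    and h: "(group_elem h :: 'g \<Rightarrow>\<^sub>0 'f) ^ s = 1" and s: "of_nat s \<noteq> (0::'f)"
  shows "\<exists>i. (group_elem h :: 'g \<Rightarrow>\<^sub>0 'f) * group_elem x = group_elem x * group_elem h ^ i"
proof -
  let ?h = "group_elem h :: 'g \<Rightarrow>\<^sub>0 'f"
  define E where "E = (\<Sum>t<s. ?h ^ t)"
  have "?h * E + 1 = (\<Sum>t<Suc s. ?h ^ t)"
    by (simp only: sum.lessThan_Suc_shift E_def sum_distrib_left) simp
  then have hE: "?h * E = E" using h by (simp add: E_def)
  then have "?h ^ t * E = E" for t by (induction t) (simp_all add: mult.assoc)
  then have EE: "E * E = of_nat s * E" by (simp add: E_def sum_distrib_right)
  define c :: 'f where "c = inverse (of_nat s)"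
  define e where "e = scalar c * E"
  have "e * r = r * e" for r
  proof (rule engel_idempotent_central[OF engel, where Y = "{?h}"])
    have "e * e = scalar (c * c) * (E * E)"
      by (simp only: e_def scalar_mult mult.assoc scalar_commute_assoc[of E])
    also have "\<dots> = scalar (c * c * of_nat s) * E"
      by (simp add: EE scalar_mult scalar_of_nat mult.assoc)
    also have "c * c * of_nat s = c" using s by (simp add: c_def)
    finally show "e * e = e" by (simp add: e_def)
    show "x * e = e * x" if "\<And>y. y \<in> {?h} \<Longrightarrow> x * y = y * x" for x
    proof -
      have "x * ?h ^ t = ?h ^ t * x" for t using that by (metis power_commuting_commutes singletonI)
      then have "x * E = E * x" by (simp add: E_def sum_distrib_left sum_distrib_right)
      then show ?thesis by (simp add: e_def scalar_commute_assoc[of x] mult.assoc)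
    qed
    from this[of ?h] show "\<And>y. y \<in> {?h} \<Longrightarrow> e * y = y * e" by simp
  qed (use h s in auto)
  moreover have "E = scalar (of_nat s) * e"
    using s by (simp add: e_def c_def flip: mult.assoc scalar_mult)
  ultimately have E_central: "E * r = r * E" for r
    by (simp only: scalar_commute_assoc[of r] mult.assoc)
  have "augmentation E = of_nat s"
  proof -
    have "augmentation (?h ^ t) = 1" for t by (induction t) (simp_all add: augmentation_mult)
    then show ?thesis by (simp add: E_def augmentation_sum)
  qed
  with s have "E \<noteq> 0" by auto
  then obtain g where g: "Poly_Mapping.lookup E g \<noteq> 0"
    by (metis lookup_zero poly_mapping_eqI)
  have single: "group_elem k = u" if "u = group_elem k'" "Poly_Mapping.lookup u k \<noteq> 0"
    for u :: "'g \<Rightarrow>\<^sub>0 'f" and k k'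
    using that by (auto simp: group_elem_def lookup_single when_def split: if_splits)
  let ?c = "group_elem (- x + h + x) :: 'g \<Rightarrow>\<^sub>0 'f"
  obtain t where t: "group_elem g = ?h ^ t"
  proof -
    from g obtain t where "Poly_Mapping.lookup (?h ^ t) g \<noteq> 0"
      unfolding E_def lookup_sum by (meson sum.neutral)
    then show ?thesis using group_elem_power[of h t] single that by metis
  qed
  have "?c * E = group_elem (- x) * ((?h * E) * group_elem x)"
    by (simp add: group_elem_add mult.assoc E_central del: hE)
  also have "\<dots> = E" by (simp add: hE E_central)
  finally have cE: "?c * E = E" .
  have "Poly_Mapping.lookup (\<Sum>t<s. ?c * ?h ^ t) g \<noteq> 0"
    using g cE by (simp add: E_def sum_distrib_left)
  then obtain t' where t'_lookup: "Poly_Mapping.lookup (?c * ?h ^ t') g \<noteq> 0"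
    unfolding lookup_sum by (meson sum.neutral)
  obtain k where "?h ^ t' = group_elem k" using group_elem_power by blast
  then have "?c * ?h ^ t' = group_elem ((- x + h + x) + k)" by (simp only: group_elem_add)
  then have t': "group_elem g = ?c * ?h ^ t'" using t'_lookup by (rule single)
  have "s \<noteq> 0" using s by (metis of_nat_0)
  then have "?h ^ t' * ?h ^ ((s - 1) * t') = (?h ^ s) ^ t'"
    unfolding power_add[symmetric] power_mult[symmetric] by (cases s) simp_all
  then have "?c = (?c * ?h ^ t') * ?h ^ ((s - 1) * t')"
    using h by (simp add: mult.assoc)
  also have "\<dots> = ?h ^ (t + (s - 1) * t')" using t t' by (simp add: power_add)
  finally have "group_elem x * ?c = group_elem x * ?h ^ (t + (s - 1) * t')" by simp
  then show ?thesis by (auto simp: group_elem_add mult.assoc)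
qed

text \<open>
  The set \<open>S\<close> of squares has more than half of the elements of the field, so it meets its image
  under \<open>y \<mapsto> - 1 - y\<close>.
\<close>

lemma sum_two_squares_eq_minus_1:
  assumes "finite (UNIV :: 'f::field set)"
  shows "\<exists>a b :: 'f. a * a + b * b = - 1"
proof -
  define S where "S = range (\<lambda>a :: 'f. a * a)"
  have fin: "finite A" for A :: "'f set" using assms by (rule finite_subset[OF subset_UNIV])
  have "card {a. a * a = y} \<le> 2" for y :: 'f
  proof (cases "\<exists>c. c * c = y")
    case True
    then obtain c where c: "c * c = y" by blast
    have "{a. a * a = y} \<subseteq> {c, - c}" using c by (auto simp: square_eq_iff)
    then have "card {a. a * a = y} \<le> card {c, - c}" by (rule card_mono[OF fin])
    also have "\<dots> \<le> 2" by (simp add: card_insert_if)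
    finally show ?thesis .
  qed auto
  then have "(\<Sum>y\<in>S - {0}. card {a. a * a = y}) \<le> (\<Sum>y\<in>S - {0}. 2)"
    by (intro sum_mono)
  also have "\<dots> = 2 * (card S - 1)" by (simp add: S_def card_Diff_singleton_if fin image_iff)
  finally have "(\<Sum>y\<in>S - {0}. card {a. a * a = y}) \<le> 2 * (card S - 1)" .
  moreover have "card (UNIV - {0 :: 'f}) \<le> card (\<Union>y\<in>S - {0}. {a. a * a = y})"
    by (rule card_mono[OF fin]) (auto simp: S_def)
  moreover have "card (\<Union>y\<in>S - {0}. {a. a * a = y}) \<le> (\<Sum>y\<in>S - {0}. card {a. a * a = y})"
    by (rule card_UN_le[OF fin])
  moreover have "card S > 0" unfolding S_def by (simp add: card_gt_0_iff fin)
  moreover have "card (UNIV :: 'f set) > 0" by (simp add: card_gt_0_iff fin)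
  moreover have "card (UNIV - {0 :: 'f}) = card (UNIV :: 'f set) - 1" by (simp add: card_Diff_singleton_if fin)
  ultimately have large: "card (UNIV :: 'f set) < 2 * card S" by linarith
  have "S \<inter> (\<lambda>y. - 1 - y) ` S \<noteq> {}"
  proof
    assume "S \<inter> (\<lambda>y. - 1 - y) ` S = {}"
    then have "card (S \<union> (\<lambda>y. - 1 - y) ` S) = card S + card ((\<lambda>y. - 1 - y) ` S)"
      by (intro card_Un_disjoint fin)
    also have "card ((\<lambda>y. - 1 - y) ` S) = card S" by (intro card_image) (auto simp: inj_on_def)
    finally have "card (S \<union> (\<lambda>y. - 1 - y) ` S) = 2 * card S" by simp
    moreover have "card (S \<union> (\<lambda>y. - 1 - y) ` S) \<le> card (UNIV :: 'f set)" by (intro card_mono fin) simp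
    ultimately show False using large by simp
  qed
  then obtain a b :: 'f where "a * a = - 1 - b * b" by (auto simp: S_def)
  then have "a * a + b * b = - 1" by simp
  then show ?thesis by blast
qed

lemma scalar_mult_commutes:
  assumes "x * y = y * x"
  shows "scalar c * x * y = y * (scalar c * x)"
  by (simp only: assms mult.assoc scalar_commute_assoc[of y])

text \<open>
  Let \<open>e = (1 - z) / 2\<close>, the idempotent on whose component \<open>z\<close> acts as \<open>-1\<close>. If \<open>A\<^sup>2 + B\<^sup>2 = -1\<close> in \<open>F\<close>, then
  \<open>w = e * (A a + B b)\<close> satisfies \<open>w\<^sup>2 = e\<close>, since \<open>a\<close> and \<open>b\<close> anticommute and have square \<open>-1\<close> there. Hence
  \<open>u = w + 1 - e\<close> is a unit of order two and \<open>f = (e + w) / 2\<close> is an idempotent in the algebra generated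
  by \<open>z\<close> and \<open>u\<close>. So \<open>f\<close> and \<open>w\<close> are central, and comparing \<open>w\<close> with \<open>a\<close> and \<open>b\<close> gives \<open>A = B = 0\<close> unless \<open>e = 0\<close>,
  that is, unless \<open>z = 1\<close>.
\<close>

lemma engel_no_quaternion:
  fixes x y :: "'g::group_add"
  assumes engel: "engel_group (normalized_units :: ('g \<Rightarrow>\<^sub>0 'f::field) monoid)"
    and finite: "finite (UNIV :: 'f set)" and two: "(2::'f) \<noteq> 0"
    and a: "a = (group_elem x :: 'g \<Rightarrow>\<^sub>0 'f)" and b: "b = group_elem y"
    and aa: "a * a = z" and bb: "b * b = z" and zz: "z * z = 1" and ab: "a * b = z * b * a"
  shows "z = 1"
proof -
  obtain A B :: 'f where AB: "A * A + B * B = - 1" using sum_two_squares_eq_minus_1[OF finite] by blast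
  have za: "z * a = a * z" unfolding aa[symmetric] by (simp add: mult.assoc)
  have zb: "z * b = b * z" unfolding bb[symmetric] by (simp add: mult.assoc)
  have half: "scalar (1 / 2) + scalar (1 / 2) = (1 :: 'g \<Rightarrow>\<^sub>0 'f)"
    using two by (simp flip: scalar_add)
  define e where "e = scalar (1 / 2) * (1 - z)"
  define S where "S = scalar A * a + scalar B * b"
  define w where "w = e * S"
  have ez: "e * z = - e" using zz by (simp add: e_def mult.assoc left_diff_distrib right_diff_distrib)
  have ea: "e * a = a * e"
    unfolding e_def using za by (intro scalar_mult_commutes) (simp add: algebra_simps)
  have eb: "e * b = b * e"
    unfolding e_def using zb by (intro scalar_mult_commutes) (simp add: algebra_simps)
  have eS: "e * S = S * e"
    using scalar_mult_commutes[of a e A] scalar_mult_commutes[of b e B] ea eb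
    by (simp add: S_def distrib_left distrib_right)
  have ee: "e * e = e"
  proof -
    have "e * (1 - z) = e + e" using ez by (simp add: right_diff_distrib)
    then have "e * e = scalar (1 / 2) * (e + e)"
      unfolding e_def by (simp only: scalar_commute_assoc[of "scalar (1/2) * (1 - z)"])
    also have "\<dots> = (scalar (1 / 2) + scalar (1 / 2)) * e" by (simp add: distrib_left distrib_right)
    finally show ?thesis by (simp add: half)
  qed
  have "S * S = scalar (A * A) * z + scalar (B * B) * z + scalar (A * B) * ((z + 1) * (b * a))"
  proof -
    have "S * S = scalar (A * A) * (a * a) + scalar (B * B) * (b * b) + scalar (A * B) * (a * b + b * a)"
      by (simp add: S_def scalar_mult mult.assoc scalar_commute_assoc[of a] scalar_commute_assoc[of b]
        distrib_left distrib_right)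
       (simp add: mult.assoc[symmetric] mult.commute[of B A] flip: scalar_mult)
    then show ?thesis by (simp add: aa bb ab distrib_right mult.assoc)
  qed
  then have "e * (S * S) = scalar (A * A) * (e * z) + scalar (B * B) * (e * z)
      + scalar (A * B) * (e * ((z + 1) * (b * a)))"
    by (simp only: distrib_left[of e] scalar_commute_assoc[of e])
  also have "e * ((z + 1) * (b * a)) = 0"
    by (simp only: mult.assoc[symmetric, of e]) (simp add: ez distrib_left)
  also have "scalar (A * A) * (e * z) + scalar (B * B) * (e * z) + scalar (A * B) * 0 =
      scalar (A * A + B * B) * (- e)"
    by (simp only: ez distrib_right scalar_add mult_zero_right add_0_right)
  also have "\<dots> = e" by (simp add: AB scalar_minus)
  finally have "e * (S * S) = e" .
  then have ww: "w * w = e"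
    unfolding w_def by (metis eS ee mult.assoc)
  have ew: "e * w = w" "w * e = w" unfolding w_def by (metis eS ee mult.assoc)+
  have ze: "z * e = e * z" unfolding e_def by (intro scalar_mult_commutes[symmetric]) (simp add: algebra_simps)
  have zw: "z * w = w * z"
  proof -
    have "z * S = S * z"
      using scalar_mult_commutes[of a z A] scalar_mult_commutes[of b z B] za zb
      by (simp add: S_def distrib_left distrib_right)
    with ze show ?thesis unfolding w_def by (metis mult.assoc)
  qed
  define u where "u = w + 1 - e"
  define f where "f = scalar (1 / 2) * (e + w)"
  have "f * r = r * f" for r
  proof (rule engel_idempotent_central[OF engel, where Y = "{z, u}"])
    have "f * f = scalar (1 / 2) * (scalar (1 / 2) * ((e + w) * (e + w)))"
      by (simp only: f_def mult.assoc scalar_commute_assoc[of "e + w"])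
    also have "(e + w) * (e + w) = (e + w) + (e + w)"
      by (simp add: ee ww ew distrib_left distrib_right)
    also have "scalar (1 / 2) * ((e + w) + (e + w)) = (scalar (1 / 2) + scalar (1 / 2)) * (e + w)"
      by (simp only: distrib_left[of "scalar (1/2)"] distrib_right[of _ _ "e + w"])
    also have "\<dots> = e + w" by (simp add: half)
    finally show "f * f = f" by (simp only: f_def)
    have "augmentation z = 1" using aa a by (auto simp: augmentation_mult)
    then have aug_e: "augmentation e = 0" by (simp add: e_def augmentation_mult augmentation_diff)
    then have "augmentation u = 1"
      by (simp add: u_def w_def augmentation_mult augmentation_diff augmentation_add)
    with \<open>augmentation z = 1\<close> show "augmentation t = 1" if "t \<in> {z, u}" for t using that by blast
    have "u * u = 1" by (simp add: u_def algebra_simps ee ww ew)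
    then show "\<exists>m. of_nat m \<noteq> (0::'f) \<and> t ^ m = 1" if "t \<in> {z, u}" for t
      using that zz two by (intro exI[of _ 2]) (auto simp: power2_eq_square)
    show gen: "t * f = f * t" if t: "\<And>v. v \<in> {z, u} \<Longrightarrow> t * v = v * t" for t
    proof -
      have "t * z = z * t" using t by blast
      then have "t * e = e * t"
        unfolding e_def by (intro scalar_mult_commutes[symmetric]) (simp add: algebra_simps)
      moreover have "t * u = u * t" using t by blast
      moreover have "w = u + e - 1" by (simp add: u_def)
      ultimately have "t * w = w * t" by (simp add: distrib_left distrib_right left_diff_distrib right_diff_distrib)
      with \<open>t * e = e * t\<close> show ?thesis
        unfolding f_def by (intro scalar_mult_commutes[symmetric]) (simp add: algebra_simps)
    qed
    have "z * u = u * z"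
      using zw ze by (simp add: u_def algebra_simps)
    then have "z * v = v * z" "u * v = v * u" if "v \<in> {z, u}" for v using that by auto
    then have "z * f = f * z" "u * f = f * u" by (blast intro: gen)+
    then show "f * t = t * f" if "t \<in> {z, u}" for t using that by auto
  qed
  then have fr: "r * f = f * r" for r by simp
  have "f + f = e + w" by (simp only: f_def distrib_right[symmetric] half mult_1_left)
  then have w_f: "w = f + f - e" by simp
  have wa: "w * a = a * w" and wb: "w * b = b * w"
    unfolding w_f by (simp_all add: fr ea eb distrib_left distrib_right left_diff_distrib right_diff_distrib)
  have inv: "t * v = 0 \<Longrightarrow> t = 0" if "v = group_elem k" for t v :: "'g \<Rightarrow>\<^sub>0 'f" and k
    using that by (metis group_elem_inverse(1) mult.assoc mult_1_right mult_zero_left)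
  have e_nz: "e \<noteq> 0" if "z \<noteq> 1"
    using that two unfolding e_def scalar_mult_eq_0_iff by simp
  show ?thesis
  proof (rule ccontr)
    assume "z \<noteq> 1"
    have eab: "e * (a * b) = - (e * (b * a))"
      unfolding ab mult.assoc[of z] by (simp add: ez flip: mult.assoc)
    have double: "t + t = scalar 2 * t" for t :: "'g \<Rightarrow>\<^sub>0 'f"
      by (metis distrib_right mult_1 one_add_one scalar_add scalar_simps(2))
    have "w * a = scalar A * (e * (a * a)) + scalar B * (e * (b * a))"
      by (simp only: w_def S_def distrib_left distrib_right mult.assoc scalar_commute_assoc[of e])
    moreover have "a * w = e * (a * S)" unfolding w_def by (metis ea mult.assoc)
    then have "a * w = scalar A * (e * (a * a)) + scalar B * (e * (a * b))"
      by (simp only: S_def distrib_left scalar_commute_assoc[of e] scalar_commute_assoc[of a])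
    ultimately have "scalar B * (e * (b * a)) = scalar B * (- (e * (b * a)))"
      using wa eab by simp
    then have "scalar B * (e * (b * a) + e * (b * a)) = 0"
      by (simp only: mult_minus_right distrib_left eq_neg_iff_add_eq_0)
    then have "B = 0" using two e_nz[OF \<open>z \<noteq> 1\<close>] inv[of "b * a" "y + x" e]
      by (auto simp: double scalar_mult_eq_0_iff a b group_elem_add)
    have "w * b = scalar A * (e * (a * b)) + scalar B * (e * (b * b))"
      by (simp only: w_def S_def distrib_left distrib_right mult.assoc scalar_commute_assoc[of e])
    moreover have "b * w = e * (b * S)" unfolding w_def by (metis eb mult.assoc)
    then have "b * w = scalar A * (e * (b * a)) + scalar B * (e * (b * b))"
      by (simp only: S_def distrib_left scalar_commute_assoc[of e] scalar_commute_assoc[of b])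
    ultimately have "scalar A * (e * (b * a)) = scalar A * (- (e * (b * a)))"
      using wb eab by simp
    then have "scalar A * (e * (b * a) + e * (b * a)) = 0"
      by (simp only: mult_minus_right distrib_left eq_neg_iff_add_eq_0)
    then have "A = 0" using two e_nz[OF \<open>z \<noteq> 1\<close>] inv[of "b * a" "y + x" e]
      by (auto simp: double scalar_mult_eq_0_iff a b group_elem_add)
    with \<open>B = 0\<close> AB show False by simp
  qed
qed

text \<open>
  For \<open>s\<close> the largest divisor of the order of \<open>G\<close> prime to \<open>p\<close> these are the \<open>p'\<close>-elements of \<open>G\<close>, taken
  inside the group algebra so that powers and cancellation are those of the ring.
\<close>

definition torsion_elems :: "nat \<Rightarrow> ('g::group_add \<Rightarrow>\<^sub>0 'f::field) set" where
  "torsion_elems s = {u. u \<in> range group_elem \<and> u ^ s = 1}"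

text \<open>
  Normality of the cyclic group of \<open>u\<close> turns \<open>(u * v) ^ n\<close> into \<open>v ^ n\<close> times a power of \<open>u\<close>, so
  \<open>(u * v) ^ (s * s) = 1\<close>; together with the exponent \<open>q * s\<close> of the whole group this leaves \<open>s\<close>.
\<close>

lemma torsion_elems_mult_closed:
  fixes u v :: "'g::group_add \<Rightarrow>\<^sub>0 'f::field"
  assumes engel: "engel_group (normalized_units :: ('g \<Rightarrow>\<^sub>0 'f) monoid)"
    and s: "of_nat s \<noteq> (0::'f)" "coprime q s"
    and exponent: "\<And>x :: 'g. (group_elem x :: 'g \<Rightarrow>\<^sub>0 'f) ^ (q * s) = 1"
    and u: "u \<in> torsion_elems s" and v: "v \<in> torsion_elems s"
  shows "u * v \<in> torsion_elems s"
proof -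
  obtain x y where xy: "u = group_elem x" "v = group_elem y"
    using u v by (auto simp: torsion_elems_def)
  have us: "u ^ s = 1" and vs: "v ^ s = 1" using u v by (auto simp: torsion_elems_def)
  obtain i where i: "u * v = v * u ^ i"
    using engel_cyclic_subgroup_normal[OF engel us[unfolded xy] s(1)] xy by blast
  have conj: "u ^ k * v = v * u ^ (i * k)" for k
  proof (induction k)
    case (Suc k)
    have "u ^ Suc k * v = u * (u ^ k * v)" by (simp add: mult.assoc)
    also have "\<dots> = (u * v) * u ^ (i * k)" by (simp add: Suc mult.assoc)
    finally show ?case by (simp add: i mult.assoc power_add)
  qed simp
  have "\<exists>k. (u * v) ^ n = v ^ n * u ^ k" for n
  proof (induction n)
    case (Suc n)
    then obtain k where k: "(u * v) ^ n = v ^ n * u ^ k" by blast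
    have "(u * v) ^ Suc n = v ^ n * (u ^ Suc k * v)"
      by (simp only: power_Suc2 k mult.assoc)
    also have "\<dots> = v ^ Suc n * u ^ (i * Suc k)" by (simp only: conj power_Suc2[of v] mult.assoc)
    finally show ?case by blast
  qed (auto intro: exI[of _ 0])
  then obtain k where "(u * v) ^ s = v ^ s * u ^ k" by blast
  then have "(u * v) ^ (s * s) = (u ^ s) ^ k" by (simp add: power_mult vs) (metis mult.commute power_mult)
  then have "(u * v) ^ (s * s) = 1" using us by simp
  moreover have "(u * v) ^ (q * s) = 1" using exponent[of "x + y"] by (simp add: xy group_elem_add)
  ultimately have "(u * v) ^ gcd (s * s) (q * s) = 1" by (rule power_gcd_eq_1)
  moreover have "gcd (s * s) (q * s) = s"
    using s(2) by (metis coprime_commute coprime_imp_gcd_eq_1 gcd_mult_distrib_nat mult.commute nat_mult_1)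
  ultimately show ?thesis by (auto simp: torsion_elems_def xy simp flip: group_elem_add)
qed

text \<open>
  A noncommuting pair would yield a quaternion pair. Its commutator \<open>z\<close> has order two and is itself
  one of the elements in question, so \<open>s\<close> is even and \<open>2\<close> is invertible in \<open>F\<close>.
\<close>

lemma torsion_elems_commute:
  fixes u v :: "'g::group_add \<Rightarrow>\<^sub>0 'f::field"
  assumes engel: "engel_group (normalized_units :: ('g \<Rightarrow>\<^sub>0 'f) monoid)"
    and finite: "finite (UNIV :: 'f set)"
    and s: "of_nat s \<noteq> (0::'f)" "coprime q s"
    and exponent: "\<And>x :: 'g. (group_elem x :: 'g \<Rightarrow>\<^sub>0 'f) ^ (q * s) = 1"
    and u: "u \<in> torsion_elems s" and v: "v \<in> torsion_elems s"
  shows "u * v = v * u"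
proof (rule ccontr)
  let ?X = "torsion_elems s :: ('g \<Rightarrow>\<^sub>0 'f) set"
  assume nc: "u * v \<noteq> v * u"
  have "0 < s" using s(1) by (metis gr0I of_nat_0)
  have normal: "\<exists>i. x * y = y * x ^ i" if "x \<in> ?X" "y \<in> ?X" for x y
    using that engel_cyclic_subgroup_normal[OF engel _ s(1)] by (auto simp: torsion_elems_def)
  have pow: "x ^ s = 1" if "x \<in> ?X" for x using that by (simp add: torsion_elems_def)
  obtain g h z where gh: "g \<in> ?X" "h \<in> ?X" "g * g = z" "h * h = z" "z * z = 1" "z \<noteq> 1"
      "g * h = z * h * g"
    using quaternion_pair_if_cyclic_normal[OF \<open>0 < s\<close> pow
      torsion_elems_mult_closed[OF engel s exponent] normal u v nc] by blast
  have "z ^ s = 1"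
    using gh torsion_elems_mult_closed[OF engel s exponent gh(1,1)] by (simp add: torsion_elems_def)
  have "(2::'f) \<noteq> 0"
  proof
    assume "(2::'f) = 0"
    then have "odd s" using s(1) by (metis dvd_def mult_zero_left of_nat_mult of_nat_numeral)
    then have "z ^ s = z"
      using gh(5) by (elim oddE) (simp add: power_mult power2_eq_square)
    with \<open>z ^ s = 1\<close> gh show False by simp
  qed
  then show False
    using engel_no_quaternion[OF engel finite _ _ _ gh(3,4,5,7)] gh by (auto simp: torsion_elems_def)
qed

text \<open>
  Let \<open>C\<close> be commutation with the group element \<open>x\<close>, which maps the commutative group of \<open>p'\<close>-elements
  into itself. If \<open>C (C v) = 1\<close>, then conjugating \<open>v\<close> by \<open>x ^ j\<close> multiplies it by \<open>w ^ j\<close> with \<open>w = C v\<close>. As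
  \<open>x ^ q\<close> is again a \<open>p'\<close>-element, it commutes with \<open>v\<close>, so \<open>w ^ q = 1\<close>; also \<open>w ^ s = 1\<close>, and \<open>w = 1\<close>.
  The Engel condition provides some iterate with \<open>(C ^^ n) u = 1\<close>, from which one descends.
\<close>

lemma torsion_elems_central:
  fixes u r :: "'g::group_add \<Rightarrow>\<^sub>0 'f::field"
  assumes engel: "engel_group (normalized_units :: ('g \<Rightarrow>\<^sub>0 'f) monoid)"
    and finite: "finite (UNIV :: 'f set)"
    and s: "of_nat s \<noteq> (0::'f)" "coprime q s"
    and exponent: "\<And>x :: 'g. (group_elem x :: 'g \<Rightarrow>\<^sub>0 'f) ^ (q * s) = 1"
    and u: "u \<in> torsion_elems s"
  shows "u * r = r * u"
proof (rule central_if_commutes_with_group)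
  fix x :: 'g
  let ?X = "torsion_elems s :: ('g \<Rightarrow>\<^sub>0 'f) set"
  let ?y = "group_elem x :: 'g \<Rightarrow>\<^sub>0 'f" and ?y' = "group_elem (- x) :: 'g \<Rightarrow>\<^sub>0 'f"
  have closed: "v * w \<in> ?X" if "v \<in> ?X" "w \<in> ?X" for v w
    using torsion_elems_mult_closed[OF engel s exponent that] .
  have commute: "v * w = w * v" if "v \<in> ?X" "w \<in> ?X" for v w
    using torsion_elems_commute[OF engel finite s exponent that] .
  have "0 < s" using s(1) by (metis gr0I of_nat_0)
  define C where "C = (\<lambda>v. commutator normalized_units v ?y)"
  have C: "v * C v = ?y' * v * ?y \<and> C v \<in> ?X" if v: "v \<in> ?X" for v
  proof -
    obtain k where k: "v = group_elem k" and vs: "v ^ s = 1" using v by (auto simp: torsion_elems_def)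
    have C_eq: "C v = group_elem (- k) * ?y' * v * ?y"
      unfolding C_def k by (intro commutator_normalized_units) simp_all
    have "group_elem (- k) ^ s * v ^ s = 1"
      unfolding k by (subst power_mult_commute[symmetric]) simp_all
    then have inv: "group_elem (- k) \<in> ?X" using vs by (simp add: torsion_elems_def)
    have "?y' * v * ?y = group_elem (- x + k + x)" by (simp only: k group_elem_add)
    moreover have "(?y' * v * ?y) ^ s = 1"
      using vs by (subst power_conjugate) simp_all
    ultimately have "?y' * v * ?y \<in> ?X" by (auto simp: torsion_elems_def)
    with inv have "group_elem (- k) * (?y' * v * ?y) \<in> ?X" by (rule closed)
    then show ?thesis by (simp add: C_eq mult.assoc) (simp add: k)
  qed
  have CC: "C v = 1" if v: "v \<in> ?X" and "C (C v) = 1" for v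
  proof -
    define w where "w = C v"
    have w: "w \<in> ?X" and vw: "?y' * v * ?y = v * w" using C[OF v] by (simp_all add: w_def)
    have fixed: "?y' * w * ?y = w" using C[OF w] that(2) by (simp add: w_def)
    have "?y' ^ j * v * ?y ^ j = v * w ^ j" for j
    proof (induction j)
      case (Suc j)
      have "?y' ^ Suc j * v * ?y ^ Suc j = ?y' * (?y' ^ j * v * ?y ^ j) * ?y"
        by (simp only: power_Suc[of ?y'] power_Suc2[of ?y] mult.assoc)
      also have "\<dots> = (?y' * v * ?y) * (?y' * w ^ j * ?y)"
        unfolding Suc by (simp add: mult.assoc)
      also have "?y' * w ^ j * ?y = w ^ j"
        using power_conjugate[of ?y ?y' w j] fixed by (cases "j = 0") simp_all
      also have "(?y' * v * ?y) * w ^ j = v * w ^ Suc j"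
        unfolding vw by (simp add: mult.assoc)
      finally show ?case .
    qed simp
    moreover have "?y ^ q \<in> ?X"
      using exponent[of x] group_elem_power[of x q] by (auto simp: torsion_elems_def power_mult)
    then have "?y' ^ q * v * ?y ^ q = ?y' ^ q * ?y ^ q * v"
      using commute[OF v] by (simp add: mult.assoc)
    moreover have "?y' ^ q * ?y ^ q = 1"
      by (subst power_mult_commute[symmetric]) simp_all
    ultimately have "v * w ^ q = v" by simp
    moreover obtain k where "v = group_elem k" using v by (auto simp: torsion_elems_def)
    ultimately have "w ^ q = 1" by (metis group_elem_inverse(2) group_elem_inverse_assoc(2))
    moreover have "w ^ s = 1" using w by (simp add: torsion_elems_def)
    ultimately show ?thesis using s(2) eq_1_if_coprime_powers_eq_1 by (metis w_def)
  qed
  have iterate: "C v = 1" if "(C ^^ k) v = 1" "v \<in> ?X" for k v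
    using that
  proof (induction k arbitrary: v)
    case 0
    then show ?case using C[of 1] by simp
  next
    case (Suc k)
    then show ?case using C CC by (simp add: funpow_swap1)
  qed
  obtain k where k: "u = group_elem k" using u by (auto simp: torsion_elems_def)
  have carrier: "group_elem i \<in> carrier (normalized_units :: ('g \<Rightarrow>\<^sub>0 'f) monoid)" for i :: 'g
    by (auto simp: normalized_units_def intro!: exI[of _ "group_elem (- i)"])
  obtain n where "(C ^^ n) u = 1"
    using engel carrier[of k] carrier[of x] unfolding engel_group_def C_def k
    by (force simp: normalized_units_def)
  then have "C u = 1" using u by (rule iterate)
  then have "?y' * u * ?y = u" using C[OF u] by simp
  then have "?y * (?y' * u * ?y) = ?y * u" by simp
  then show "u * ?y = ?y * u" by (simp add: mult.assoc)
qed

section \<open>Finite groups whose elements of order prime to p are central\<close>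

lemma (in group) subgroup_pow_card:
  assumes H: "subgroup H G" and x: "x \<in> H"
  shows "x [^] card H = \<one>"
proof -
  interpret H: group "G\<lparr>carrier := H\<rparr>" using H by (rule subgroup_imp_group)
  have "x [^]\<^bsub>G\<lparr>carrier := H\<rparr>\<^esub> order (G\<lparr>carrier := H\<rparr>) = \<one>\<^bsub>G\<lparr>carrier := H\<rparr>\<^esub>"
    using x by (intro H.pow_order_eq_1) simp
  then show ?thesis by (simp add: order_def flip: nat_pow_consistent)
qed

lemma (in group) eq_one_if_coprime_pows:
  assumes "x \<in> carrier G" "x [^] (a::nat) = \<one>" "x [^] (b::nat) = \<one>" "coprime a b"
  shows "x = \<one>"
proof -
  have "ord x dvd gcd a b" using assms(1-3) pow_eq_id by simp
  then have "ord x = 1" unfolding coprime_imp_gcd_eq_1[OF assms(4)] by simp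
  then show ?thesis using assms ord_eq_1 by simp
qed

lemma prime_to_p_cofactor_dvd:
  fixes s c :: nat
  assumes "c \<noteq> 0" "s \<noteq> 0" "\<not> p dvd s"
    and "\<And>r. Factorial_Ring.prime r \<Longrightarrow> r \<noteq> p \<Longrightarrow> r ^ multiplicity r s dvd c"
  shows "s dvd c"
proof (rule multiplicity_le_imp_dvd)
  fix r :: nat assume r: "Factorial_Ring.prime r"
  show "multiplicity r s \<le> multiplicity r c"
  proof (cases "r = p")
    case True
    then show ?thesis using assms(3) by (simp add: not_dvd_imp_multiplicity_0)
  next
    case False
    then show ?thesis using assms(1,4) r by (intro multiplicity_geI) auto
  qed
qed (use assms in auto)

text \<open>
  A Sylow \<open>p\<close>-subgroup and the central subgroup of elements killed by \<open>s\<close> have coprime exponents, so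
  once their orders are known to multiply to that of \<open>G\<close> they form a direct decomposition.
\<close>

locale central_p_complement = group G for G (structure) +
  fixes p k s :: nat
  assumes finite_carrier: "finite (carrier G)"
    and prime: "Factorial_Ring.prime p"
    and order: "order G = p ^ k * s"
    and not_dvd: "\<not> p dvd s"
    and central: "\<And>x y. x \<in> carrier G \<Longrightarrow> x [^] s = \<one> \<Longrightarrow> y \<in> carrier G \<Longrightarrow> x \<otimes> y = y \<otimes> x"
begin

definition "p_part = {x \<in> carrier G. x [^] (p ^ k) = \<one>}"

definition "complement = {x \<in> carrier G. x [^] s = \<one>}"

lemma coprime_parts: "coprime (p ^ k) s"
  using prime not_dvd by (simp add: prime_imp_coprime)

lemma subgroup_complement: "subgroup complement G"
proof (rule subgroupI)
  show "inv x \<in> complement" if "x \<in> complement" for x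
    using that by (simp add: complement_def nat_pow_inv)
  show "x \<otimes> y \<in> complement" if "x \<in> complement" "y \<in> complement" for x y
    using that central[of x y] by (simp add: complement_def pow_mult_distrib)
qed (auto simp: complement_def)

lemma s_pos: "0 < s"
  using not_dvd by (cases s) auto

text \<open>
  For each prime \<open>r\<close> other than \<open>p\<close> a Sylow \<open>r\<close>-subgroup lies in the complement, so \<open>s\<close> divides the order
  of the complement. For a Sylow \<open>p\<close>-subgroup \<open>S\<close> the product map from \<open>S \<times> complement\<close> is injective, so
  by counting it is bijective, and then every element killed by \<open>p ^ k\<close> lies in \<open>S\<close>.
\<close>

lemma p_part_subgroup: "subgroup p_part G"
  and card_p_part: "card p_part = p ^ k"
  and product_bij: "bij_betw (\<lambda>(x, y). x \<otimes> y) (p_part \<times> complement) (carrier G)"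
proof -
  obtain S where S: "subgroup S G" "card S = p ^ k"
    using sylow_thm[OF prime group_axioms order finite_carrier] by blast
  have S_sub: "x \<in> carrier G" "x [^] (p ^ k) = \<one>" if "x \<in> S" for x
    using that S subgroup_pow_card subgroup.mem_carrier by fastforce+
  have fin: "finite complement" "finite S"
    using finite_carrier subgroup.subset[OF S(1)] by (auto simp: complement_def intro: finite_subset)
  have card_pos: "card complement > 0"
    using fin subgroup.one_closed[OF subgroup_complement] by (auto simp: card_gt_0_iff)
  have "s dvd card complement"
  proof (rule prime_to_p_cofactor_dvd[OF _ _ not_dvd])
    fix r :: nat assume r: "Factorial_Ring.prime r" "r \<noteq> p"
    define m where "m = multiplicity r s"
    obtain t where t: "s = r ^ m * t" unfolding m_def by (metis multiplicity_dvd dvdE)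
    then have "order G = r ^ m * (p ^ k * t)" using order by simp
    then obtain H where H: "subgroup H G" "card H = r ^ m"
      using sylow_thm[OF r(1) group_axioms _ finite_carrier] by blast
    have "H \<subseteq> complement"
    proof
      fix x assume x: "x \<in> H"
      have "x \<in> carrier G" using H(1) x by (rule subgroup.mem_carrier)
      moreover from this have "x [^] s = (x [^] (r ^ m)) [^] t" by (simp only: t nat_pow_pow)
      moreover have "x [^] (r ^ m) = \<one>" using subgroup_pow_card[OF H(1) x] by (simp only: H)
      ultimately show "x \<in> complement"  by (simp add: complement_def)
    qed
    have "subgroup H (G\<lparr>carrier := complement\<rparr>)"
      using H(1) subgroup_complement \<open>H \<subseteq> complement\<close> by (rule subgroup_incl)
    then have "card H dvd order (G\<lparr>carrier := complement\<rparr>)"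
      using group.lagrange[OF subgroup_imp_group[OF subgroup_complement]] by (metis dvd_triv_right)
    then show "r ^ multiplicity r s dvd card complement" by (simp add: H order_def m_def)
  qed (use card_pos s_pos in auto)
  then have ge: "s \<le> card complement" using card_pos by (simp add: dvd_imp_le)
  have inj: "inj_on (\<lambda>(x, y). x \<otimes> y) (S \<times> complement)"
  proof (rule inj_onI, clarify)
    fix x y x' y' assume mem: "x \<in> S" "y \<in> complement" "x' \<in> S" "y' \<in> complement"
      and eq: "x \<otimes> y = x' \<otimes> y'"
    have carrier: "x \<in> carrier G" "y \<in> carrier G" "x' \<in> carrier G" "y' \<in> carrier G"
      using mem S_sub by (auto simp: complement_def)
    have "inv x' \<otimes> x = y' \<otimes> inv y"
    proof -
      have "inv x' \<otimes> (x \<otimes> y) \<otimes> inv y = inv x' \<otimes> (x' \<otimes> y') \<otimes> inv y" by (simp only: eq)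
      then show ?thesis using carrier by (simp add: m_assoc inv_solve_left) (simp add: m_assoc[symmetric])
    qed
    moreover have S_mem: "inv x' \<otimes> x \<in> S" using mem S(1) by (simp add: subgroup.m_closed subgroup.m_inv_closed)
    moreover have "y' \<otimes> inv y \<in> complement"
      using mem subgroup_complement by (simp add: subgroup.m_closed subgroup.m_inv_closed)
    ultimately have "(inv x' \<otimes> x) [^] s = \<one>" by (simp add: complement_def)
    then have "inv x' \<otimes> x = \<one>"
      using eq_one_if_coprime_pows[OF S_sub[OF S_mem] _ coprime_parts] by simp
    then have "x' \<otimes> (inv x' \<otimes> x) = x'" using carrier by simp
    then have "x = x'" using carrier by (simp add: m_assoc[symmetric])
    moreover from this have "y = y'" using eq carrier by simp
    ultimately show "x = x' \<and> y = y'" by simp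
  qed
  have image: "(\<lambda>(x, y). x \<otimes> y) ` (S \<times> complement) \<subseteq> carrier G"
    using S_sub by (auto simp: complement_def)
  have "p ^ k * card complement \<le> p ^ k * s"
    using card_inj_on_le[OF inj image finite_carrier] S(2) order
    by (simp add: card_cartesian_product order_def)
  then have card_complement: "card complement = s" using ge prime by (simp add: prime_gt_0_nat)
  have "(\<lambda>(x, y). x \<otimes> y) ` (S \<times> complement) = carrier G"
    using card_image[OF inj] card_complement S(2) order
    by (intro card_subset_eq finite_carrier image) (simp add: card_cartesian_product order_def)
  then have bij: "bij_betw (\<lambda>(x, y). x \<otimes> y) (S \<times> complement) (carrier G)"
    using inj by (simp add: bij_betw_def)
  have "p_part = S"
  proof
    show "S \<subseteq> p_part" using S_sub by (auto simp: p_part_def)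
    show "p_part \<subseteq> S"
    proof
      fix g assume g: "g \<in> p_part"
      then have "g \<in> (\<lambda>(x, y). x \<otimes> y) ` (S \<times> complement)"
        using bij by (simp add: bij_betw_def p_part_def)
      then obtain x y where xy: "x \<in> S" "y \<in> complement" "g = x \<otimes> y" by auto
      have carrier: "x \<in> carrier G" "y \<in> carrier G" "y [^] s = \<one>"
        using xy S_sub by (auto simp: complement_def)
      have "g [^] (p ^ k) = x [^] (p ^ k) \<otimes> y [^] (p ^ k)"
        using xy(3) carrier central[of y x] by (simp add: pow_mult_distrib)
      then have "y [^] (p ^ k) = \<one>" using g S_sub[OF xy(1)] carrier by (simp add: p_part_def)
      then have "y = \<one>"
        using eq_one_if_coprime_pows[OF carrier(2) _ carrier(3) coprime_parts] by simp
      then show "g \<in> S" using xy carrier by simp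
    qed
  qed
  with S bij show "subgroup p_part G" "card p_part = p ^ k"
    "bij_betw (\<lambda>(x, y). x \<otimes> y) (p_part \<times> complement) (carrier G)" by auto
qed

lemma sylow_iff_p_part: "sylow_subgroup p G Q \<longleftrightarrow> Q = p_part"
proof -
  have "multiplicity p (order G) = k"
    using prime not_dvd s_pos unfolding order
    by (simp add: prime_elem_multiplicity_mult_distrib not_dvd_imp_multiplicity_0)
  then have sylow: "sylow_subgroup p G Q \<longleftrightarrow> subgroup Q G \<and> card Q = p ^ k" for Q
    by (simp add: sylow_subgroup_def)
  show ?thesis
  proof
    assume "sylow_subgroup p G Q"
    then have Q: "subgroup Q G" "card Q = p ^ k" by (simp_all add: sylow)
    then have "Q \<subseteq> p_part"
      using subgroup_pow_card subgroup.mem_carrier by (fastforce simp: p_part_def)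
    then show "Q = p_part"
      using Q card_p_part finite_carrier by (intro card_subset_eq) (auto simp: p_part_def)
  qed (simp add: sylow p_part_subgroup card_p_part)
qed

lemma internal_direct_product_parts: "internal_direct_product G p_part complement"
proof -
  have "(\<lambda>(x, y). x \<otimes> y) \<in> hom (G\<lparr>carrier := p_part\<rparr> \<times>\<times> G\<lparr>carrier := complement\<rparr>) G"
  proof (rule homI)
    fix a b assume "a \<in> carrier (G\<lparr>carrier := p_part\<rparr> \<times>\<times> G\<lparr>carrier := complement\<rparr>)"
      "b \<in> carrier (G\<lparr>carrier := p_part\<rparr> \<times>\<times> G\<lparr>carrier := complement\<rparr>)"
    then obtain x y x' y' where ab: "a = (x, y)" "b = (x', y')"
      and carrier: "x \<in> carrier G" "y \<in> carrier G" "x' \<in> carrier G" "y' \<in> carrier G" "y [^] s = \<one>"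
      by (auto simp: DirProd_def p_part_def complement_def)
    have "x \<otimes> x' \<otimes> (y \<otimes> y') = x \<otimes> (x' \<otimes> y) \<otimes> y'" using carrier by (simp add: m_assoc)
    also have "x' \<otimes> y = y \<otimes> x'" using central carrier by simp
    finally show "(\<lambda>(x, y). x \<otimes> y) (a \<otimes>\<^bsub>G\<lparr>carrier := p_part\<rparr> \<times>\<times> G\<lparr>carrier := complement\<rparr>\<^esub> b) =
        (case a of (x, y) \<Rightarrow> x \<otimes> y) \<otimes> (case b of (x, y) \<Rightarrow> x \<otimes> y)"
      using carrier by (simp add: ab DirProd_def m_assoc)
  qed (auto simp: DirProd_def p_part_def complement_def)
  then show ?thesis
    using product_bij p_part_subgroup subgroup_complement
    by (auto simp: internal_direct_product_def iso_def DirProd_def)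
qed

lemma central_subgroup_complement: "central_subgroup G complement"
  using subgroup_complement central by (auto simp: central_subgroup_def complement_def)

lemma derived_subset_p_part: "derived G (carrier G) \<subseteq> p_part"
  unfolding derived_def
proof (rule generate_subgroup_incl[OF _ p_part_subgroup], clarify)
  fix g h assume "g \<in> carrier G" "h \<in> carrier G"
  then have "g \<in> (\<lambda>(x, y). x \<otimes> y) ` (p_part \<times> complement)"
      "h \<in> (\<lambda>(x, y). x \<otimes> y) ` (p_part \<times> complement)"
    using product_bij by (simp_all add: bij_betw_def)
  then obtain x a y b where gh: "g = x \<otimes> a" "h = y \<otimes> b"
    and mem: "x \<in> p_part" "a \<in> complement" "y \<in> p_part" "b \<in> complement" by auto
  have carrier: "x \<in> carrier G" "a \<in> carrier G" "y \<in> carrier G" "b \<in> carrier G"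
    using mem by (auto simp: p_part_def complement_def)
  have ca: "a \<otimes> z = z \<otimes> a" and cb: "b \<otimes> z = z \<otimes> b" if "z \<in> carrier G" for z
    using that mem central by (auto simp: complement_def)
  have "g \<otimes> h = (x \<otimes> y) \<otimes> (a \<otimes> b)"
    using carrier ca[of y] unfolding gh by (metis m_assoc m_closed)
  moreover have "h \<otimes> g = (y \<otimes> x) \<otimes> (a \<otimes> b)"
    using carrier cb[of x] ca[of b] unfolding gh by (metis m_assoc m_closed)
  moreover have "g \<otimes> h \<otimes> inv g \<otimes> inv h = (g \<otimes> h) \<otimes> inv (h \<otimes> g)"
    using carrier by (simp add: gh inv_mult_group m_assoc)
  ultimately have "g \<otimes> h \<otimes> inv g \<otimes> inv h = (x \<otimes> y) \<otimes> inv (y \<otimes> x)"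
    using carrier by (simp add: inv_mult_group m_assoc) (simp add: m_assoc[symmetric])
  then show "g \<otimes> h \<otimes> inv g \<otimes> inv h \<in> p_part"
    using mem p_part_subgroup by (simp add: subgroup.m_closed subgroup.m_inv_closed)
qed

end

section \<open>Fixed points of p-groups\<close>

text \<open>
  The fibres of \<open>g \<mapsto> f g x\<close> are translates of the stabilizer of \<open>x\<close>. Acting groups are subgroups of
  a type here because both subgroups of \<open>G\<close> and additive subgroups of \<open>FG\<close> will act.
\<close>

lemma card_orbit_dvd:
  fixes P :: "'g::group_add set" and f :: "'g \<Rightarrow> 'e \<Rightarrow> 'e"
  assumes P: "finite P" "0 \<in> P" "\<And>g h. g \<in> P \<Longrightarrow> h \<in> P \<Longrightarrow> g + h \<in> P" "\<And>g. g \<in> P \<Longrightarrow> - g \<in> P"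
    and f: "\<And>x. f 0 x = x" "\<And>g h x. f (g + h) x = f g (f h x)"
  shows "card ((\<lambda>g. f g x) ` P) dvd card P"
proof -
  have fibre: "card {g \<in> P. f g x = f h x} = card {g \<in> P. f g x = x}" if h: "h \<in> P" for h
  proof (rule bij_betw_same_card)
    show "bij_betw (\<lambda>g. - h + g) {g \<in> P. f g x = f h x} {g \<in> P. f g x = x}"
    proof (rule bij_betwI[where g = "\<lambda>g. h + g"])
      show "(\<lambda>g. - h + g) \<in> {g \<in> P. f g x = f h x} \<rightarrow> {g \<in> P. f g x = x}"
        using h P by (auto simp: f(2)) (metis f add.left_inverse)
      show "(\<lambda>g. h + g) \<in> {g \<in> P. f g x = x} \<rightarrow> {g \<in> P. f g x = f h x}"
        using h P by (auto simp: f(2))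
    qed (simp_all add: add.assoc[symmetric])
  qed
  have "card P = (\<Sum>y\<in>(\<lambda>g. f g x) ` P. card {g \<in> P. f g x = y})"
    using sum.image_gen[OF P(1), of "\<lambda>_. 1::nat" "\<lambda>g. f g x"] by simp
  also have "\<dots> = (\<Sum>y\<in>(\<lambda>g. f g x) ` P. card {g \<in> P. f g x = x})"
    using fibre by (intro sum.cong) auto
  finally show ?thesis by simp
qed

lemma p_group_fixed_points:
  fixes P :: "'g::group_add set" and f :: "'g \<Rightarrow> 'e \<Rightarrow> 'e" and p :: nat
  assumes p: "Factorial_Ring.prime p" and card_P: "card P = p ^ k"
    and P: "0 \<in> P" "\<And>g h. g \<in> P \<Longrightarrow> h \<in> P \<Longrightarrow> g + h \<in> P" "\<And>g. g \<in> P \<Longrightarrow> - g \<in> P"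
    and f: "\<And>x. f 0 x = x" "\<And>g h x. f (g + h) x = f g (f h x)"
    and E: "finite E" "\<And>g x. g \<in> P \<Longrightarrow> x \<in> E \<Longrightarrow> f g x \<in> E"
  shows "p dvd card (E - {x \<in> E. \<forall>g\<in>P. f g x = x})"
proof -
  have fin: "finite P" using card_P p by (metis card.infinite power_eq_0_iff not_prime_0)
  let ?orb = "\<lambda>x. (\<lambda>g. f g x) ` P"
  let ?N = "E - {x \<in> E. \<forall>g\<in>P. f g x = x}"
  have undo: "f (- g) (f g x) = x" for g x using f by (metis add.left_inverse)
  have self: "x \<in> ?orb x" for x using P(1) f(1) by (metis image_eqI)
  have eq: "?orb y = ?orb x" if y: "y \<in> ?orb x" for x y
  proof -
    obtain g where g: "g \<in> P" "y = f g x" using y by blast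
    have "f h y \<in> ?orb x" if "h \<in> P" for h
      using g that P(2) by (intro image_eqI[of _ _ "h + g"]) (simp_all add: f(2))
    moreover have "f h x \<in> ?orb y" if "h \<in> P" for h
      using g that P(2)[of h "- g"] P(3)[of g]
      by (intro image_eqI[of _ _ "h + - g"]) (simp_all add: f(2) undo del: add_uminus_conv_diff)
    ultimately show ?thesis by blast
  qed
  have orb_N: "?orb x \<subseteq> ?N" if x: "x \<in> ?N" for x
  proof clarify
    fix g assume g: "g \<in> P"
    have "\<not> (\<forall>h\<in>P. f h (f g x) = f g x)"
    proof
      assume fixed: "\<forall>h\<in>P. f h (f g x) = f g x"
      then have "f (- g) (f g x) = f g x" using P(3) g by blast
      then have "x = f g x" by (simp add: undo)
      with fixed x show False by auto
    qed
    with E(2) g x show "f g x \<in> ?N" by auto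
  qed
  have "p dvd card (\<Union>(?orb ` ?N))"
  proof (rule dvd_partition)
    show "finite (\<Union>(?orb ` ?N))" using fin E(1) by auto
    show "\<forall>c\<in>?orb ` ?N. p dvd card c"
    proof
      fix c assume "c \<in> ?orb ` ?N"
      then obtain x where x: "x \<in> ?N" "c = ?orb x" by blast
      have "card c dvd p ^ k"
        unfolding x card_P[symmetric] using fin P f by (rule card_orbit_dvd)
      then obtain j where j: "card c = p ^ j" using p divides_primepow_nat by blast
      obtain g where "g \<in> P" "f g x \<noteq> x" using x by auto
      then have "{x, f g x} \<subseteq> c" using self x by auto
      then have "card {x, f g x} \<le> card c" using fin x by (intro card_mono) auto
      then have "0 < j" using j \<open>f g x \<noteq> x\<close> by (cases j) auto
      then show "p dvd card c" unfolding j by (simp add: dvd_power)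
    qed
    show "\<forall>c1\<in>?orb ` ?N. \<forall>c2\<in>?orb ` ?N. c1 \<noteq> c2 \<longrightarrow> c1 \<inter> c2 = {}"
      using eq by blast
  qed
  also have "\<Union>(?orb ` ?N) = ?N" using orb_N self by blast
  finally show ?thesis .
qed

section \<open>The radical filtration of the augmentation ideal of a p-group\<close>

text \<open>
  Both \<open>P\<close>, by multiplication, and the cyclic group of order \<open>p\<close> generated by some \<open>v \<notin> K\<close>, by
  translation, act on the cosets of \<open>K\<close>. Translation by \<open>v\<close> has no fixed coset, so the number of
  cosets is divisible by \<open>p\<close>. Hence so is the number of cosets fixed by \<open>P\<close>, and as \<open>K\<close> is one of
  them, there is another.
\<close>

lemma proper_submodule_fixed_coset:
  fixes P :: "'g::group_add set" and K :: "('g \<Rightarrow>\<^sub>0 'f::field) set"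
  assumes finite: "finite (UNIV :: ('g \<Rightarrow>\<^sub>0 'f) set)"
    and p: "Factorial_Ring.prime p" "CHAR('f) = p" and card_P: "card P = p ^ k"
    and P: "0 \<in> P" "\<And>g h. g \<in> P \<Longrightarrow> h \<in> P \<Longrightarrow> g + h \<in> P" "\<And>g. g \<in> P \<Longrightarrow> - g \<in> P"
    and K: "0 \<in> K" "\<And>x y. x \<in> K \<Longrightarrow> y \<in> K \<Longrightarrow> x - y \<in> K"
      "\<And>g x. g \<in> P \<Longrightarrow> x \<in> K \<Longrightarrow> group_elem g * x \<in> K"
    and proper: "K \<noteq> UNIV"
  shows "\<exists>m. m \<notin> K \<and> (\<forall>g\<in>P. (group_elem g - 1) * m \<in> K)"
proof -
  define coset where "coset m = {y. y - m \<in> K}" for m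
  have uminus: "- x \<in> K" if "x \<in> K" for x using K(2)[OF K(1) that] by simp
  have plus: "x + y \<in> K" if "x \<in> K" "y \<in> K" for x y using K(2)[OF that(1) uminus[OF that(2)]] by simp
  have coset_eq: "coset m = coset n \<longleftrightarrow> m - n \<in> K" for m n
  proof
    assume "coset m = coset n"
    moreover have "m \<in> coset m" using K(1) by (simp add: coset_def)
    ultimately show "m - n \<in> K" by (simp add: coset_def)
  next
    assume mn: "m - n \<in> K"
    have "y - m \<in> K \<longleftrightarrow> y - n \<in> K" for y
      using plus[OF _ mn, of "y - m"] K(2)[OF _ mn, of "y - n"] by (auto simp: algebra_simps)
    then show "coset m = coset n" by (simp add: coset_def)
  qed
  define E where "E = range coset"
  have fin_E: "finite E" using finite unfolding E_def by (rule finite_imageI)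
  define act where "act g c = {y. group_elem (- g) * y \<in> c}" for g :: 'g and c :: "('g \<Rightarrow>\<^sub>0 'f) set"
  have act_coset: "act g (coset m) = coset (group_elem g * m)" if g: "g \<in> P" for g m
  proof -
    have "group_elem (- g) * y - m \<in> K \<longleftrightarrow> y - group_elem g * m \<in> K" for y
      using K(3)[OF g, of "group_elem (- g) * y - m"] K(3)[OF P(3)[OF g], of "y - group_elem g * m"]
      by (auto simp: right_diff_distrib)
    then show ?thesis by (simp add: act_def coset_def)
  qed
  let ?Fix = "{c \<in> E. \<forall>g\<in>P. act g c = c}"
  have "p dvd card (E - ?Fix)"
  proof (rule p_group_fixed_points[OF p(1) card_P P])
    show "act (g + h) x = act g (act h x)" for g h x
      by (simp only: act_def minus_add group_elem_add mult.assoc mem_Collect_eq)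
    show "act g x \<in> E" if "g \<in> P" "x \<in> E" for g x
      using that act_coset by (auto simp: E_def)
  qed (use fin_E in \<open>auto simp: act_def\<close>)
  moreover have "p dvd card E"
  proof -
    obtain v where v: "v \<notin> K" using proper by blast
    have [simp]: "v \<noteq> 0" using v K(1) by auto
    \<comment> \<open>The additive group generated by v, of order p; multiples by naturals suffice because p * v = 0.\<close>
    let ?T = "range (\<lambda>j::nat. of_nat j * v)"
    define shift where "shift u c = {y. y - u \<in> c}" for u :: "'g \<Rightarrow>\<^sub>0 'f" and c
    have of_nat_p: "of_nat p = (0 :: 'g \<Rightarrow>\<^sub>0 'f)"
      using of_nat_CHAR[where 'a = 'f] p(2) scalar_of_nat[of p, where 'a = 'g and 'b = 'f] by simp
    have "?T = (\<lambda>j. of_nat j * v) ` {..<p}"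
    proof
      have "of_nat j * v = of_nat (j mod p) * v" for j
      proof -
        have "(of_nat j :: 'g \<Rightarrow>\<^sub>0 'f) = of_nat (p * (j div p) + j mod p)" by simp
        also have "\<dots> = of_nat (j mod p)" by (simp only: of_nat_add of_nat_mult of_nat_p) simp
        finally show ?thesis by simp
      qed
      then show "?T \<subseteq> (\<lambda>j. of_nat j * v) ` {..<p}"
        using p(1) by (auto intro!: image_eqI[of _ _ "_ mod p"] simp: prime_gt_0_nat)
    qed auto
    moreover have "inj_on (\<lambda>j. of_nat j * v) {..<p}"
    proof (rule inj_onI)
      have "i = j" if "of_nat i * v = of_nat j * v" "j < p" "i \<le> j" for i j
      proof -
        have "of_nat (j - i) * v = 0" using that by (simp add: of_nat_diff left_diff_distrib)
        then have "p dvd j - i"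
          using p(2) by (simp add: of_nat_mult_eq_0_iff of_nat_eq_0_iff_char_dvd)
        then show ?thesis using that by (auto dest: dvd_imp_le)
      qed
      then show "i = j" if "i \<in> {..<p}" "j \<in> {..<p}" "of_nat i * v = of_nat j * v" for i j
        using that by (metis lessThan_iff nat_le_linear)
    qed
    ultimately have "card ?T = p ^ 1" by (simp add: card_image)
    have "p dvd card (E - {c \<in> E. \<forall>u\<in>?T. shift u c = c})"
    proof (rule p_group_fixed_points[OF p(1) \<open>card ?T = p ^ 1\<close>])
      show "0 \<in> ?T" by (rule image_eqI[of _ _ 0]) simp_all
      show "t + u \<in> ?T" if "t \<in> ?T" "u \<in> ?T" for t u
        using that by (auto simp flip: distrib_right of_nat_add)
      show "- t \<in> ?T" if t: "t \<in> ?T" for t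
      proof -
        obtain j where j: "t = of_nat j * v" using t by blast
        have "of_nat ((p - 1) * j) * v + t = of_nat ((p - 1) * j + j) * v"
          by (simp only: j of_nat_add distrib_right)
        also have "(p - 1) * j + j = p * j" using p(1) by (cases p) auto
        also have "of_nat (p * j) * v = 0" by (simp add: of_nat_p)
        finally have "- t = of_nat ((p - 1) * j) * v"
          by (simp only: eq_neg_iff_add_eq_0[symmetric])
        then show ?thesis by blast
      qed
      show "shift (t + u) x = shift t (shift u x)" for t u x
        by (simp add: shift_def algebra_simps)
      have "shift t (coset m) = coset (m + t)" for t m
        by (simp add: shift_def coset_def algebra_simps)
      then show "shift t x \<in> E" if "t \<in> ?T" "x \<in> E" for t x
        using that by (auto simp: E_def)
    qed (use fin_E in \<open>auto simp: shift_def\<close>)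
    moreover have "shift v (coset m) \<noteq> coset m" for m
    proof
      assume "shift v (coset m) = coset m"
      then have "coset (m + v) = coset m" by (simp add: shift_def coset_def algebra_simps)
      with v show False by (simp add: coset_eq)
    qed
    then have "{c \<in> E. \<forall>u\<in>?T. shift u c = c} = {}"
      by (auto simp: E_def) (metis mult_1 of_nat_1)
    ultimately show ?thesis by (simp only: Diff_empty)
  qed
  moreover have "card E = card (E - ?Fix) + card ?Fix"
    using fin_E by (subst card_Un_disjoint[symmetric]) (auto intro!: arg_cong[where f = card])
  ultimately have "p dvd card ?Fix" using dvd_add_right_iff[of p "card (E - ?Fix)" "card ?Fix"] by simp
  have zero_fix: "coset 0 \<in> ?Fix" using act_coset by (auto simp: E_def)
  have "?Fix \<noteq> {coset 0}"
  proof
    assume "?Fix = {coset 0}"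
    then have "card ?Fix = 1" by simp
    with \<open>p dvd card ?Fix\<close> p(1) show False by simp
  qed
  with zero_fix obtain c where c: "c \<in> ?Fix" "c \<noteq> coset 0" by blast
  then obtain m where m: "c = coset m" by (auto simp: E_def)
  have "m \<notin> K" using c(2) by (simp add: m coset_eq)
  moreover have "(group_elem g - 1) * m \<in> K" if "g \<in> P" for g
  proof -
    have "coset (group_elem g * m) = coset m"
      using c(1) that unfolding m act_coset[OF that, symmetric] by blast
    then show ?thesis by (simp add: coset_eq left_diff_distrib)
  qed
  ultimately show ?thesis by blast
qed

text \<open>
  The socle series of \<open>FG\<close> as a module over \<open>P\<close>: \<open>loewy P n\<close> consists of the elements that
  the \<open>n\<close>-th power of the augmentation ideal of \<open>P\<close> annihilates from the left.
\<close>

primrec loewy :: "'g::group_add set \<Rightarrow> nat \<Rightarrow> ('g \<Rightarrow>\<^sub>0 'f::field) set" where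
  "loewy P 0 = {0}"
| "loewy P (Suc n) = {m. \<forall>g\<in>P. (group_elem g - 1) * m \<in> loewy P n}"

lemma loewy_0 [simp]: "0 \<in> loewy P n"
  by (induction n) auto

lemma loewy_add: "x \<in> loewy P n \<Longrightarrow> y \<in> loewy P n \<Longrightarrow> x + y \<in> loewy P n"
  by (induction n arbitrary: x y) (auto simp: distrib_left)

lemma loewy_diff: "x \<in> loewy P n \<Longrightarrow> y \<in> loewy P n \<Longrightarrow> x - y \<in> loewy P n"
  by (induction n arbitrary: x y) (auto simp: right_diff_distrib)

lemma loewy_sum: "(\<And>i. i \<in> A \<Longrightarrow> f i \<in> loewy P n) \<Longrightarrow> sum f A \<in> loewy P n"
  by (induction A rule: infinite_finite_induct) (auto intro: loewy_add)

lemma loewy_scalar: "x \<in> loewy P n \<Longrightarrow> scalar c * x \<in> loewy P n"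
  by (induction n arbitrary: x) (auto simp: scalar_commute_assoc)

lemma loewy_group_elem:
  assumes normal: "\<And>g x. x \<in> P \<Longrightarrow> - g + x + g \<in> P"
  shows "m \<in> loewy P n \<Longrightarrow> group_elem g * m \<in> loewy P n"
proof (induction n arbitrary: m)
  case (Suc n)
  have "(group_elem x - 1) * (group_elem g * m) \<in> loewy P n" if x: "x \<in> P" for x
  proof -
    have "(group_elem x - 1) * (group_elem g * m) = group_elem g * ((group_elem (- g + x + g) - 1) * m)"
      by (simp add: group_elem_add left_diff_distrib right_diff_distrib mult.assoc)
    also have "(group_elem (- g + x + g) - 1) * m \<in> loewy P n"
      using Suc.prems normal[OF x] by simp
    then have "group_elem g * ((group_elem (- g + x + g) - 1) * m) \<in> loewy P n"
      by (rule Suc.IH)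
    finally show ?thesis .
  qed
  then show ?case by simp
qed simp

lemma loewy_mult:
  assumes normal: "\<And>g x. x \<in> P \<Longrightarrow> - g + x + g \<in> P" and m: "m \<in> loewy P n"
  shows "r * m \<in> loewy P n"
proof -
  have "(\<Sum>g\<in>Poly_Mapping.keys r. scalar (Poly_Mapping.lookup r g) * group_elem g) * m \<in> loewy P n"
    unfolding sum_distrib_right mult.assoc
    by (intro loewy_sum loewy_scalar loewy_group_elem[OF normal m])
  then show ?thesis by (simp only: sum_scalar_group_elem)
qed

lemma loewy_Suc:
  assumes normal: "\<And>g x. x \<in> P \<Longrightarrow> - g + x + g \<in> P"
  shows "loewy P n \<subseteq> loewy P (Suc n)"
  unfolding loewy.simps left_diff_distrib mult_1_left
  using loewy_mult[OF normal] loewy_diff by blast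

text \<open>
  Each step of the series is strict until the whole algebra is reached, by the existence of a second
  fixed coset, and the algebra is finite.
\<close>

lemma loewy_eq_UNIV:
  fixes P :: "'g::group_add set"
  assumes finite: "finite (UNIV :: ('g \<Rightarrow>\<^sub>0 'f::field) set)"
    and p: "Factorial_Ring.prime p" "CHAR('f) = p" and card_P: "card P = p ^ k"
    and P: "0 \<in> P" "\<And>g h. g \<in> P \<Longrightarrow> h \<in> P \<Longrightarrow> g + h \<in> P" "\<And>g. g \<in> P \<Longrightarrow> - g \<in> P"
    and normal: "\<And>g x. x \<in> P \<Longrightarrow> - g + x + g \<in> P"
  shows "\<exists>n. loewy P n = (UNIV :: ('g \<Rightarrow>\<^sub>0 'f) set)"
proof -
  let ?L = "loewy P :: nat \<Rightarrow> ('g \<Rightarrow>\<^sub>0 'f) set"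
  have fin: "finite (?L n)" for n using finite by (rule finite_subset[OF subset_UNIV])
  have "?L n = UNIV \<or> n < card (?L n)" for n
  proof (induction n)
    case (Suc n)
    note sub = loewy_Suc[OF normal, of n, where 'b = 'f]
    show ?case
    proof (cases "?L n = UNIV")
      case False
      then obtain m where "m \<notin> ?L n" "\<forall>g\<in>P. (group_elem g - 1) * m \<in> ?L n"
        using proper_submodule_fixed_coset[OF finite p card_P P loewy_0 loewy_diff loewy_mult[OF normal]]
        by blast
      then have "?L n \<subset> ?L (Suc n)" using sub by auto
      then have "card (?L n) < card (?L (Suc n))" by (rule psubset_card_mono[OF fin])
      with Suc False show ?thesis by simp
    qed (use sub in auto)
  qed simp
  from this[of "card (UNIV :: ('g \<Rightarrow>\<^sub>0 'f) set)"] show ?thesis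
    using card_mono[OF finite subset_UNIV] by (metis linorder_not_le)
qed

text \<open>
  Elements that lower the socle series by \<open>n\<close> steps take the place of the \<open>n\<close>-th power of the
  augmentation ideal of \<open>P\<close>. They contain it, they are multiplicative in \<open>n\<close> by definition, and they
  vanish once the series is exhausted.
\<close>

definition loewy_ideal :: "'g::group_add set \<Rightarrow> nat \<Rightarrow> ('g \<Rightarrow>\<^sub>0 'f::field) set" where
  "loewy_ideal P n = {x. \<forall>k. \<forall>m\<in>loewy P (k + n). x * m \<in> loewy P k}"

lemma loewy_ideal_diff: "x \<in> loewy_ideal P n \<Longrightarrow> y \<in> loewy_ideal P n \<Longrightarrow> x - y \<in> loewy_ideal P n"
  by (simp add: loewy_ideal_def left_diff_distrib loewy_diff)

lemma loewy_ideal_add: "x \<in> loewy_ideal P n \<Longrightarrow> y \<in> loewy_ideal P n \<Longrightarrow> x + y \<in> loewy_ideal P n"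
  by (simp add: loewy_ideal_def distrib_right loewy_add)

lemma loewy_ideal_0 [simp]: "0 \<in> loewy_ideal P n"
  by (simp add: loewy_ideal_def)

lemma loewy_ideal_sum: "(\<And>i. i \<in> A \<Longrightarrow> f i \<in> loewy_ideal P n) \<Longrightarrow> sum f A \<in> loewy_ideal P n"
  by (induction A rule: infinite_finite_induct) (auto intro: loewy_ideal_add)

lemma loewy_ideal_mult:
  assumes "x \<in> loewy_ideal P a" "y \<in> loewy_ideal P b"
  shows "x * y \<in> loewy_ideal P (a + b)"
  using assms by (auto simp: loewy_ideal_def mult.assoc add.assoc[symmetric])

lemma loewy_ideal_group_elem_minus_1: "g \<in> P \<Longrightarrow> group_elem g - 1 \<in> loewy_ideal P 1"
  by (simp add: loewy_ideal_def)

lemma loewy_ideal_subset_0: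
  fixes P :: "'g::group_add set"
  assumes "loewy P n = (UNIV :: ('g \<Rightarrow>\<^sub>0 'f::field) set)"
  shows "loewy_ideal P n \<subseteq> {0 :: 'g \<Rightarrow>\<^sub>0 'f}"
proof
  fix x :: "'g \<Rightarrow>\<^sub>0 'f" assume "x \<in> loewy_ideal P n"
  then have "\<forall>m\<in>loewy P (0 + n). x * m \<in> loewy P 0" unfolding loewy_ideal_def by blast
  then have "x * 1 \<in> loewy P 0" using assms by (metis UNIV_I add_0)
  then show "x \<in> {0}" by simp
qed

context
  fixes P :: "'g::group_add set"
  assumes normal: "\<And>g x. x \<in> P \<Longrightarrow> - g + x + g \<in> P"
begin

lemma loewy_ideal_zeroth: "loewy_ideal P 0 = UNIV"
  by (auto simp: loewy_ideal_def loewy_mult[OF normal])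

lemma loewy_ideal_mult_left: "x \<in> loewy_ideal P n \<Longrightarrow> r * x \<in> loewy_ideal P n"
  using loewy_ideal_mult[of r P 0 x n] by (simp add: loewy_ideal_zeroth)

lemma loewy_ideal_mult_right: "x \<in> loewy_ideal P n \<Longrightarrow> x * r \<in> loewy_ideal P n"
  using loewy_ideal_mult[of x P n r 0] by (simp add: loewy_ideal_zeroth)

text \<open>
  Replacing each group element \<open>x + a\<close>, with \<open>x \<in> P\<close> and \<open>a\<close> central, by \<open>a\<close> changes it by
  \<open>(x - 1) * a\<close>, an element of the augmentation ideal of \<open>P\<close> (in the notation of the algebra).
\<close>

lemma central_modulo_loewy_ideal:
  fixes y :: "'g \<Rightarrow>\<^sub>0 'f::field"
  assumes decomp: "\<And>g. \<exists>x\<in>P. \<exists>a. g = x + a \<and> (\<forall>r :: 'g \<Rightarrow>\<^sub>0 'f. group_elem a * r = r * group_elem a)"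
  obtains c where "\<And>r. c * r = r * c" "y - c \<in> loewy_ideal P 1"
proof -
  obtain x a where xa: "\<And>g. x g \<in> P" "\<And>g. g = x g + a g"
    "\<And>g (r :: 'g \<Rightarrow>\<^sub>0 'f). group_elem (a g) * r = r * group_elem (a g)"
    using decomp by metis
  define c where "c = (\<Sum>g\<in>Poly_Mapping.keys y. scalar (Poly_Mapping.lookup y g) * group_elem (a g))"
  show ?thesis
  proof
    show "c * r = r * c" for r
      unfolding c_def sum_distrib_left sum_distrib_right
      by (intro sum.cong refl) (simp only: mult.assoc scalar_commute_assoc[of r] xa(3))
    have "y - c = (\<Sum>g\<in>Poly_Mapping.keys y. scalar (Poly_Mapping.lookup y g) * group_elem g) - c"
      by (simp only: sum_scalar_group_elem)
    also have "\<dots> = (\<Sum>g\<in>Poly_Mapping.keys y. scalar (Poly_Mapping.lookup y g) * (group_elem g - group_elem (a g)))"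
      by (simp add: c_def sum_subtractf right_diff_distrib)
    also have "\<dots> \<in> loewy_ideal P 1"
    proof (intro loewy_ideal_sum loewy_ideal_mult_left)
      fix g
      have "group_elem g = group_elem (x g) * group_elem (a g)"
        using xa(2)[of g] by (simp flip: group_elem_add)
      then have "group_elem g - group_elem (a g) = (group_elem (x g) - 1) * group_elem (a g)"
        by (simp add: left_diff_distrib)
      also have "\<dots> \<in> loewy_ideal P 1"
        by (intro loewy_ideal_mult_right loewy_ideal_group_elem_minus_1 xa)
      finally show "group_elem g - group_elem (a g) \<in> (loewy_ideal P 1 :: ('g \<Rightarrow>\<^sub>0 'f) set)" .
    qed
    finally show "y - c \<in> loewy_ideal P 1" .
  qed
qed

text \<open>
  These are the congruence subgroups of the ideals \<open>loewy_ideal P n\<close>, the analogues of \<open>1 + I\<^sup>n\<close>.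
\<close>

lemma congruence_subgroup:
  "subgroup {u \<in> carrier normalized_units. u - 1 \<in> loewy_ideal P n}
    (normalized_units :: ('g \<Rightarrow>\<^sub>0 'f::field) monoid)" (is "subgroup ?H ?V")
proof -
  interpret V: group ?V by (rule group_normalized_units)
  show ?thesis
  proof (rule V.subgroupI)
    have "1 \<in> ?H" using V.one_closed by (simp add: normalized_units_def)
    then show "?H \<noteq> {}" by blast
    fix u assume u: "u \<in> ?H"
    define v where "v = inv\<^bsub>?V\<^esub> u"
    have "v \<in> carrier ?V" "v \<otimes>\<^bsub>?V\<^esub> u = \<one>\<^bsub>?V\<^esub>" using u by (simp_all add: v_def)
    then have "v * u = 1" by (simp add: normalized_units_def)
    then have "v - 1 = 0 - v * (u - 1)" by (simp add: right_diff_distrib)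
    moreover have "v * (u - 1) \<in> loewy_ideal P n"
      using u by (intro loewy_ideal_mult_left) simp
    then have "0 - v * (u - 1) \<in> loewy_ideal P n" by (rule loewy_ideal_diff[OF loewy_ideal_0])
    ultimately show "inv\<^bsub>?V\<^esub> u \<in> ?H" using \<open>v \<in> carrier ?V\<close> unfolding v_def by simp
    fix w assume w: "w \<in> ?H"
    have "u * w - 1 = (u - 1) * w + (w - 1)" by (simp add: left_diff_distrib)
    also have "\<dots> \<in> loewy_ideal P n"
      using u w by (intro loewy_ideal_add loewy_ideal_mult_right) simp_all
    finally show "u \<otimes>\<^bsub>?V\<^esub> w \<in> ?H"
      using u w V.m_closed[of u w] by (simp add: normalized_units_def)
  qed auto
qed

text \<open>
  With \<open>c\<close> central, \<open>x * y - y * x = (x - 1) * (y - c) - (y - c) * (x - 1)\<close>. If \<open>x - 1\<close> has filtration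
  degree \<open>n\<close> and \<open>y - c\<close> has degree \<open>1\<close>, then the additive commutator, and with it the group commutator
  minus \<open>1\<close>, has degree \<open>n + 1\<close>.
\<close>

lemma lower_central_subset_congruence:
  assumes decomp: "\<And>g. \<exists>x\<in>P. \<exists>a. g = x + a \<and> (\<forall>r :: 'g \<Rightarrow>\<^sub>0 'f::field. group_elem a * r = r * group_elem a)"
  shows "lower_central (normalized_units :: ('g \<Rightarrow>\<^sub>0 'f) monoid) n
    \<subseteq> {u \<in> carrier normalized_units. u - 1 \<in> loewy_ideal P n}"
proof (induction n)
  case 0
  show ?case by (auto simp: loewy_ideal_zeroth)
next
  case (Suc n)
  let ?V = "normalized_units :: ('g \<Rightarrow>\<^sub>0 'f) monoid"
  interpret V: group ?V by (rule group_normalized_units)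
  have "commutator ?V x y \<in> {u \<in> carrier ?V. u - 1 \<in> loewy_ideal P (Suc n)}"
    if x: "x \<in> lower_central ?V n" and y: "y \<in> carrier ?V" for x y
  proof -
    have x_V: "x \<in> carrier ?V" and x_I: "x - 1 \<in> loewy_ideal P n" using x Suc.IH by auto
    obtain c where c: "\<And>r. c * r = r * c" "y - c \<in> loewy_ideal P 1"
      using central_modulo_loewy_ideal[OF decomp] by metis
    obtain x' where x': "x * x' = 1" "x' * x = 1" "augmentation x = 1"
      using x_V by (auto simp: normalized_units_def)
    obtain y' where y': "y * y' = 1" "y' * y = 1" "augmentation y = 1"
      using y by (auto simp: normalized_units_def)
    have comm: "commutator ?V x y = x' * y' * x * y"
      using x' y' by (rule commutator_normalized_units)
    have comm_V: "commutator ?V x y \<in> carrier ?V" unfolding commutator_def using x_V y by simp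
    have I: "(x - 1) * (y - c) \<in> loewy_ideal P (Suc n)" "(y - c) * (x - 1) \<in> loewy_ideal P (Suc n)"
      using loewy_ideal_mult[OF x_I c(2)] loewy_ideal_mult[OF c(2) x_I] by simp_all
    have "x' * y' * x * y - 1 = x' * y' * (x * y - y * x)"
    proof -
      have "x' * y' * (y * x) = x' * (y' * y) * x" by (simp only: mult.assoc)
      then have "x' * y' * (y * x) = 1" using x' y' by simp
      then show ?thesis by (simp add: right_diff_distrib mult.assoc)
    qed
    also have "x * y - y * x = (x - 1) * (y - c) - (y - c) * (x - 1)"
      using c(1)[of x] by (simp add: algebra_simps)
    also have "x' * y' * ((x - 1) * (y - c) - (y - c) * (x - 1)) \<in> loewy_ideal P (Suc n)"
      using loewy_ideal_mult_left[OF loewy_ideal_diff[OF I]] .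
    finally show ?thesis using comm_V by (simp add: comm)
  qed
  then show ?case
    unfolding lower_central.simps
    by (intro V.generate_subgroup_incl congruence_subgroup) blast
qed

end

theorem nilpotent_normalized_units:
  fixes P :: "'g::group_add set"
  assumes finite: "finite (UNIV :: ('g \<Rightarrow>\<^sub>0 'f::field) set)"
    and p: "Factorial_Ring.prime p" "CHAR('f) = p" and card_P: "card P = p ^ k"
    and P: "0 \<in> P" "\<And>g h. g \<in> P \<Longrightarrow> h \<in> P \<Longrightarrow> g + h \<in> P" "\<And>g. g \<in> P \<Longrightarrow> - g \<in> P"
    and normal: "\<And>g x. x \<in> P \<Longrightarrow> - g + x + g \<in> P"
    and decomp: "\<And>g. \<exists>x\<in>P. \<exists>a. g = x + a \<and> (\<forall>r :: 'g \<Rightarrow>\<^sub>0 'f. group_elem a * r = r * group_elem a)"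
  shows "nilpotent_group (normalized_units :: ('g \<Rightarrow>\<^sub>0 'f) monoid)"
proof -
  let ?V = "normalized_units :: ('g \<Rightarrow>\<^sub>0 'f) monoid"
  interpret V: group ?V by (rule group_normalized_units)
  obtain n where "loewy P n = (UNIV :: ('g \<Rightarrow>\<^sub>0 'f) set)"
    using loewy_eq_UNIV[OF finite p card_P P normal] by blast
  then have "lower_central ?V n \<subseteq> {\<one>\<^bsub>?V\<^esub>}"
    using lower_central_subset_congruence[OF normal decomp, of n] loewy_ideal_subset_0
    by (fastforce simp: normalized_units_def)
  moreover have "\<one>\<^bsub>?V\<^esub> \<in> lower_central ?V n"
    by (cases n) (auto intro: generate.one)
  ultimately show ?thesis
    unfolding nilpotent_group_def using V.group_axioms by blast
qed

section \<open>Group algebras without nilpotent elements\<close>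

text \<open>
  Commutativity is a hypothesis here and not a type class, since it depends on the group; the
  identity is obtained by interpreting the locale of commutative semirings.
\<close>

lemma freshmans_dream_commuting:
  fixes x y :: "'a::ring_1"
  assumes comm: "\<And>x y :: 'a. x * y = y * x"
    and p: "Factorial_Ring.prime p" "CHAR('a) = p"
  shows "(x + y) ^ p = x ^ p + y ^ p"
proof -
  interpret comm: comm_semiring_1 "(*)" "1 :: 'a" "(+)" 0
    by standard (use comm in \<open>auto simp: algebra_simps\<close>)
  have pow: "power.power 1 (*) x n = x ^ n" for x :: 'a and n
    by (induction n) (simp_all add: power.power.power_0 power.power.power_Suc)
  have semiring_1: "class.semiring_1 (1 :: 'a) (*) (+) 0" by unfold_locales
  have "semiring_1.of_nat 1 (+) (0 :: 'a) = of_nat"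
    by (simp add: fun_eq_iff semiring_1.of_nat_def[OF semiring_1] of_nat_def)
  then have char: "semiring_1.semiring_char 1 (+) 0 TYPE('a) = p"
    using p(2) unfolding semiring_1.semiring_char_def[OF semiring_1] semiring_char_def by simp
  have "power.power 1 (*) (x + y) p = power.power 1 (*) x p + power.power 1 (*) y p"
    by (rule comm.freshmans_dream) (simp_all only: char p(1))
  then show ?thesis by (simp only: pow)
qed

lemma CHAR_group_algebra:
  "CHAR('g::group_add \<Rightarrow>\<^sub>0 'f::field) = CHAR('f)"
proof (rule CHAR_eqI)
  show "of_nat CHAR('f) = (0 :: 'g \<Rightarrow>\<^sub>0 'f)"
    using scalar_of_nat[of "CHAR('f)", where 'a = 'g and 'b = 'f] by simp
  show "CHAR('f) dvd n" if "of_nat n = (0 :: 'g \<Rightarrow>\<^sub>0 'f)" for n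
    using that of_nat_mult_eq_0_iff[of n "1 :: 'g \<Rightarrow>\<^sub>0 'f"] by (simp add: of_nat_eq_0_iff_char_dvd)
qed

text \<open>
  The \<open>p\<close>-th power map is additive, and \<open>g \<mapsto> g ^ p\<close> is injective on a group of exponent prime to \<open>p\<close>.
  Thus the coefficients of \<open>y ^ p\<close> are the \<open>p\<close>-th powers of those of \<open>y\<close>, and \<open>y ^ p = 0\<close> implies \<open>y = 0\<close>.
\<close>

lemma reduced_if_commutative_p_prime:
  fixes x :: "'g::group_add \<Rightarrow>\<^sub>0 'f::field"
  assumes comm: "\<And>x y :: 'g \<Rightarrow>\<^sub>0 'f. x * y = y * x"
    and p: "Factorial_Ring.prime p" "CHAR('f) = p" "coprime p s"
    and exponent: "\<And>g :: 'g. (group_elem g :: 'g \<Rightarrow>\<^sub>0 'f) ^ s = 1"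
    and x: "x ^ n = 0"
  shows "x = 0"
proof -
  have frob_add: "(a + b) ^ p = a ^ p + b ^ p" for a b :: "'g \<Rightarrow>\<^sub>0 'f"
    using comm p(1) by (rule freshmans_dream_commuting) (simp add: CHAR_group_algebra p(2))
  have "p \<noteq> 0" using p(1) by auto
  have frob_sum: "(\<Sum>i\<in>A. f i) ^ p = (\<Sum>i\<in>A. f i ^ p)" for f :: "'g \<Rightarrow> 'g \<Rightarrow>\<^sub>0 'f" and A
    using \<open>p \<noteq> 0\<close>
    by (induction A rule: infinite_finite_induct) (simp_all add: frob_add power_0_left)
  have "\<exists>k. group_elem k = (group_elem g :: 'g \<Rightarrow>\<^sub>0 'f) ^ p" for g
    using group_elem_power[of g p, where 'b = 'f] by auto
  then obtain \<pi> where \<pi>: "\<And>g. group_elem (\<pi> g) = (group_elem g :: 'g \<Rightarrow>\<^sub>0 'f) ^ p"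
    by metis
  have inj: "g = h" if "\<pi> g = \<pi> h" for g h
  proof -
    have "group_elem (- h) ^ p * group_elem h ^ p = (1 :: 'g \<Rightarrow>\<^sub>0 'f)"
      by (subst power_mult_commute[symmetric]) simp_all
    moreover have "(group_elem h :: 'g \<Rightarrow>\<^sub>0 'f) ^ p = group_elem g ^ p" using that by (simp flip: \<pi>)
    moreover have "(group_elem (- h + g) :: 'g \<Rightarrow>\<^sub>0 'f) ^ p = group_elem (- h) ^ p * group_elem g ^ p"
      unfolding group_elem_add by (rule power_mult_commute) (rule comm)
    ultimately have "(group_elem (- h + g) :: 'g \<Rightarrow>\<^sub>0 'f) ^ p = 1" by simp
    then have "(group_elem (- h + g) :: 'g \<Rightarrow>\<^sub>0 'f) = 1"
      using exponent p(3) by (rule eq_1_if_coprime_powers_eq_1)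
    then have "- h + g = 0" by (metis group_elem_0 group_elem_eq_iff)
    then show "g = h" by (simp add: add_eq_0_iff)
  qed
  have frob_inj: "y = 0" if "y ^ p = 0" for y :: "'g \<Rightarrow>\<^sub>0 'f"
  proof (rule poly_mapping_eqI)
    fix g0
    have "y ^ p = (\<Sum>g\<in>Poly_Mapping.keys y. scalar (Poly_Mapping.lookup y g) * group_elem g) ^ p"
      by (simp only: sum_scalar_group_elem)
    also have "\<dots> = (\<Sum>g\<in>Poly_Mapping.keys y. scalar (Poly_Mapping.lookup y g) ^ p * group_elem (\<pi> g))"
      unfolding frob_sum \<pi> by (intro sum.cong refl power_mult_commute comm)
    also have "\<dots> = (\<Sum>g\<in>Poly_Mapping.keys y. Poly_Mapping.single (\<pi> g) (Poly_Mapping.lookup y g ^ p))"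
    proof (intro sum.cong refl)
      fix g
      have "scalar c ^ k = (scalar (c ^ k) :: 'g \<Rightarrow>\<^sub>0 'f)" for c k
        by (induction k) (simp_all add: scalar_mult)
      then show "scalar (Poly_Mapping.lookup y g) ^ p * group_elem (\<pi> g) =
          Poly_Mapping.single (\<pi> g) (Poly_Mapping.lookup y g ^ p)"
        by (simp add: scalar_def group_elem_def mult_single)
    qed
    finally have "0 = Poly_Mapping.lookup (\<Sum>g\<in>Poly_Mapping.keys y.
        Poly_Mapping.single (\<pi> g) (Poly_Mapping.lookup y g ^ p)) (\<pi> g0)"
      using that by simp
    also have "\<dots> = (\<Sum>g\<in>Poly_Mapping.keys y. if g = g0 then Poly_Mapping.lookup y g ^ p else 0)"
      unfolding lookup_sum lookup_single by (intro sum.cong refl) (auto simp: when_def dest: inj)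
    also have "\<dots> = Poly_Mapping.lookup y g0 ^ p"
      using \<open>p \<noteq> 0\<close> by (simp add: in_keys_iff)
    finally show "Poly_Mapping.lookup y g0 = Poly_Mapping.lookup 0 g0" by simp
  qed
  have iterate: "y ^ p ^ k = 0 \<Longrightarrow> y = 0" for k and y :: "'g \<Rightarrow>\<^sub>0 'f"
    by (induction k) (simp_all add: power_Suc2 power_mult frob_inj del: power_Suc)
  have "n \<le> p ^ n" using power_gt_expt[of p n] prime_gt_1_nat[OF p(1)] by simp
  then have "x ^ p ^ n = x ^ n * x ^ (p ^ n - n)" by (simp flip: power_add)
  then show ?thesis using x iterate by simp
qed

section \<open>The structure of the group and nilpotency of the unit group\<close>

lemma group_elem_pow:
  "group_elem (x [^]\<^bsub>base_group\<^esub> (n::nat)) = group_elem x ^ n"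
proof -
  interpret group "base_group :: 'a monoid" by (rule group_base_group)
  show ?thesis
    by (induction n) (simp_all add: base_group_def group_elem_add power_commutes)
qed

lemma pow_eq_one_iff:
  "x [^]\<^bsub>base_group\<^esub> (n::nat) = \<one>\<^bsub>base_group\<^esub> \<longleftrightarrow> (group_elem x :: 'g::group_add \<Rightarrow>\<^sub>0 'f::field) ^ n = 1"
  by (metis base_group_def group_elem_0 group_elem_eq_iff group_elem_pow monoid.select_convs(2))

text \<open>
  Writing the order of \<open>G\<close> as \<open>p ^ k * s\<close> with \<open>s\<close> prime to \<open>p\<close>, the elements killed by \<open>s\<close> are central.
  A trivial Sylow \<open>p\<close>-subgroup would make \<open>G\<close> equal to this central part, and \<open>FG\<close> commutative without
  nilpotent elements, against the existence of \<open>x\<close>.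
\<close>

theorem engel_group_algebra_structure:
  fixes x :: "'g::group_add \<Rightarrow>\<^sub>0 'f::field"
  assumes finite: "finite (UNIV :: 'f set)" "finite (UNIV :: 'g set)"
    and p: "Factorial_Ring.prime p" "CHAR('f) = p"
    and x: "x \<noteq> 0" "x ^ n = 0"
    and engel: "engel_group (normalized_units :: ('g \<Rightarrow>\<^sub>0 'f) monoid)"
  defines "G \<equiv> base_group :: 'g monoid"
  shows "nilpotent_group (normalized_units :: ('g \<Rightarrow>\<^sub>0 'f) monoid)"
    and "\<exists>P A. (\<forall>Q. sylow_subgroup p G Q \<longleftrightarrow> Q = P) \<and> internal_direct_product G P A \<and>
      P \<noteq> {\<one>\<^bsub>G\<^esub>} \<and> derived G (carrier G) \<subseteq> P \<and> central_subgroup G A"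
proof -
  interpret group G unfolding G_def by (rule group_base_group)
  have G: "carrier G = UNIV" "\<And>a b. a \<otimes>\<^bsub>G\<^esub> b = a + b" "\<one>\<^bsub>G\<^esub> = 0"
    by (simp_all add: G_def base_group_def)
  have pow_iff: "a [^]\<^bsub>G\<^esub> m = \<one>\<^bsub>G\<^esub> \<longleftrightarrow> (group_elem a :: 'g \<Rightarrow>\<^sub>0 'f) ^ m = 1" for a and m :: nat
    unfolding G_def by (rule pow_eq_one_iff)
  have "order G \<noteq> 0" using finite(2) by (simp add: order_def G card_gt_0_iff)
  then obtain s where s: "order G = p ^ multiplicity p (order G) * s" "\<not> p dvd s"
    using p(1) by (metis multiplicity_decompose' not_prime_unit)
  define k where "k = multiplicity p (order G)"
  have order: "order G = p ^ k * s" using s(1) by (simp add: k_def)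
  have exponent: "(group_elem a :: 'g \<Rightarrow>\<^sub>0 'f) ^ (p ^ k * s) = 1" for a
    using pow_order_eq_1[of a] by (simp add: G order flip: pow_iff)
  have coprime: "coprime p s" using p(1) s(2) by (simp add: prime_imp_coprime)
  then have coprime_k: "coprime (p ^ k) s" by simp
  have s_unit: "of_nat s \<noteq> (0::'f)" using s(2) p(2) by (simp add: of_nat_eq_0_iff_char_dvd)
  have torsion_central: "group_elem a * r = r * group_elem a"
    if "a [^]\<^bsub>G\<^esub> s = \<one>\<^bsub>G\<^esub>" for a and r :: "'g \<Rightarrow>\<^sub>0 'f"
    using that torsion_elems_central[OF engel finite(1) s_unit coprime_k exponent]
    by (simp add: torsion_elems_def pow_iff)
  interpret central_p_complement G p k s
  proof
    show "Finite_Set.finite (carrier G)" using finite(2) by (simp add: G)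
    show "a \<otimes>\<^bsub>G\<^esub> b = b \<otimes>\<^bsub>G\<^esub> a" if "a [^]\<^bsub>G\<^esub> s = \<one>\<^bsub>G\<^esub>" for a b
      using torsion_central[OF that, of "group_elem b"] by (simp add: G flip: group_elem_add)
  qed (fact p(1) order s(2))+
  have decomp: "\<exists>y\<in>p_part. \<exists>a. g = y + a \<and> a [^]\<^bsub>G\<^esub> s = \<one>\<^bsub>G\<^esub>" for g
  proof -
    have "g \<in> (\<lambda>(x, y). x \<otimes>\<^bsub>G\<^esub> y) ` (p_part \<times> complement)"
      using product_bij by (simp add: bij_betw_def G)
    then show ?thesis by (auto simp: complement_def G)
  qed
  have "p_part \<noteq> {\<one>\<^bsub>G\<^esub>}"
  proof
    assume trivial: "p_part = {\<one>\<^bsub>G\<^esub>}"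
    have all: "g [^]\<^bsub>G\<^esub> s = \<one>\<^bsub>G\<^esub>" for g using decomp[of g] trivial by (auto simp: G)
    have "a * b = b * a" for a b :: "'g \<Rightarrow>\<^sub>0 'f"
      using central_if_commutes_with_group torsion_central[OF all] by metis
    then have "x = 0"
      using p coprime all x(2) unfolding pow_iff by (rule reduced_if_commutative_p_prime)
    with x(1) show False by simp
  qed
  then show "\<exists>P A. (\<forall>Q. sylow_subgroup p G Q \<longleftrightarrow> Q = P) \<and> internal_direct_product G P A \<and>
      P \<noteq> {\<one>\<^bsub>G\<^esub>} \<and> derived G (carrier G) \<subseteq> P \<and> central_subgroup G A"
    using sylow_iff_p_part internal_direct_product_parts derived_subset_p_part central_subgroup_complement
    by blast
  show "nilpotent_group (normalized_units :: ('g \<Rightarrow>\<^sub>0 'f) monoid)"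
  proof (rule nilpotent_normalized_units[OF finite_group_algebra[OF finite] p card_p_part])
    show "0 \<in> p_part" using subgroup.one_closed[OF p_part_subgroup] by (simp add: G)
    show "g + h \<in> p_part" if "g \<in> p_part" "h \<in> p_part" for g h
      using subgroup.m_closed[OF p_part_subgroup that] by (simp add: G)
    show "- g \<in> p_part" if "g \<in> p_part" for g
    proof -
      have "inv\<^bsub>G\<^esub> g = - g" by (rule inv_equality) (simp_all add: G)
      then show ?thesis using subgroup.m_inv_closed[OF p_part_subgroup that] by simp
    qed
    show "- g + y + g \<in> p_part" if "y \<in> p_part" for g y
    proof -
      have "(group_elem y :: 'g \<Rightarrow>\<^sub>0 'f) ^ p ^ k = 1" using that by (simp add: p_part_def pow_iff)
      then have "(group_elem (- g + y + g) :: 'g \<Rightarrow>\<^sub>0 'f) ^ p ^ k = 1"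
        unfolding group_elem_add by (subst power_conjugate) simp_all
      then show ?thesis by (simp add: p_part_def pow_iff G(1))
    qed
    show "\<exists>y\<in>p_part. \<exists>a. g = y + a \<and> (\<forall>r :: 'g \<Rightarrow>\<^sub>0 'f. group_elem a * r = r * group_elem a)" for g
      using decomp[of g] torsion_central by blast
  qed
qed

theorem theorem1:
  assumes "finite {x :: 'g::group_add \<Rightarrow>\<^sub>0 'f::field. x \<noteq> 0 \<and> (\<exists>n. x ^ n = 0)}"
    and "{x :: 'g \<Rightarrow>\<^sub>0 'f. x \<noteq> 0 \<and> (\<exists>n. x ^ n = 0)} \<noteq> {}"
  shows "finite (UNIV :: 'f set) \<and>
    (\<exists>p. Factorial_Ring.prime p \<and> CHAR('f) = p \<and>
      (engel_group (normalized_units :: ('g \<Rightarrow>\<^sub>0 'f) monoid) \<longrightarrow>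
        nilpotent_group (normalized_units :: ('g \<Rightarrow>\<^sub>0 'f) monoid) \<and>
        finite (UNIV :: 'g set) \<and>
        (let G = (base_group :: 'g monoid) in
          \<exists>P A. (\<forall>Q. sylow_subgroup p G Q \<longleftrightarrow> Q = P) \<and>
            internal_direct_product G P A \<and>
            P \<noteq> {\<one>\<^bsub>G\<^esub>} \<and>
            derived G (carrier G) \<subseteq> P \<and>
            central_subgroup G A)))"
proof -
  obtain x :: "'g \<Rightarrow>\<^sub>0 'f" and n where x: "x \<noteq> 0" "x ^ n = 0" using assms(2) by blast
  have F: "finite (UNIV :: 'f set)" using assms(1) x by (rule finite_field_if_finite_nilpotents)
  have G: "finite (UNIV :: 'g set)" using assms(1) x by (rule finite_group_if_finite_nilpotents)
  have p: "Factorial_Ring.prime CHAR('f)"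
    using F by (intro prime_CHAR_semidom finite_imp_CHAR_pos)
  show ?thesis
    using F G p engel_group_algebra_structure[OF F G p refl x] by (auto simp: Let_def)
qed

end
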